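(* Let $X=\{X_Q\}_Q$ be a family of normalized quasi-Banach function spaces, indexed by the cubes $Q\subset\mathbb{R}^n$. The following statements are equivalent: (i) $\mathrm{BMO}\hookrightarrow\mathrm{BMO}_X$, i.e. there is a constant $C>0$ such that $\|f\|_{\mathrm{BMO}_X}\le C\|f\|_{\mathrm{BMO}}$ for all $f\in\mathrm{BMO}$. (ii) $\mathrm{BMO}=\mathrm{BMO}_{MX}$ (equality of spaces with equivalent seminorms).
   Context: Cubes $Q\subset\mathbb{R}^n$ have sides parallel to the axes, and $\langle f\rangle_Q:=\frac1{|Q|}\int_Q f$. A quasi-Banach function space over a cube $Q$ is an order ideal $X_Q$ of the space of measurable functions $Q\to\mathbb{R}$, equipped with a quasi-norm $\|\cdot\|_{X_Q}$, such that: (Compatibility) if $f,g\in X_Q$ and $|f|\le|g|$ then $\|f\|_{X_Q}\le\|g\|_{X_Q}$; (Weak order unit) there is $f\in X_Q$ with $f>0$ a.e.; (Fatou property) if $0\le f_m\uparrow f$ with $f_m \in X_Q$ and $\sup_m\|f_m\|_{X_Q}<\infty$, then $f\in X_Q$ and $\|f\|_{X_Q}=\sup_m\|f_m\|_{X_Q}$. We put $\|f\|_{X_Q}=\infty$ if $f\notin X_Q$; for $f$ defined on $\mathbb{R}^n$, $\|f\|_{X_Q}$ means the quasi-norm of the restriction of $f$ to $Q$. $X=\{X_Q\}$ is a family of normalized quasi-Banach function spaces if for every cube $Q$, $X_Q$ is a quasi-Banach function space over $Q$ and $\|\chi_Q\|_{X_Q}\simeq1$, with constants independent of $Q$. $\mathrm{BMO}$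 is the space of locally integrable $f:\mathbb{R}^n\to\mathbb{R}$ with $\|f\|_{\mathrm{BMO}}:=\sup_Q\frac1{|Q|}\int_Q|f-\langle f\rangle_Q|<\infty$. $\mathrm{BMO}_X$ is the space of locally integrable $f:\mathbb{R}^n\to\mathbb{R}$ with $\|f\|_{\mathrm{BMO}_X}:=\sup_Q\|f-\langle f\rangle_Q\|_{X_Q}<\infty$. $\mathcal{D}(Q)$ is the set of all dyadic cubes with respect to $Q$: the cubes obtained by repeated subdivision of $Q$ and each of its descendants into $2^n$ congruent subcubes (including $Q$ itself). The local dyadic maximal operator is $M_Qf:=\sup_{P\in\mathcal{D}(Q)}\langle|f|\rangle_P\chi_P$. $\mathrm{BMO}_{MX}$ is the space of locally integrable $f:\mathbb{R}^n\to\mathbb{R}$ with $\|f\|_{\mathrm{BMO}_{MX}}:=\sup_Q\|M_Q(f-\langle f\rangle_Q)\|_{X_Q}<\infty$. *)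

theory Defs
  imports "HOL-Analysis.Analysis"
begin

text \<open>
  Cubes are closed. Since function spaces over a cube do not see null sets, the choice of
  which faces belong to a cube is immaterial.
\<close>

definition is_cube :: "'a::euclidean_space set \<Rightarrow> bool" where
  "is_cube Q \<longleftrightarrow> (\<exists>a l. l > 0 \<and> Q = cbox a (a + l *\<^sub>R One))"

text \<open>
  A subset \<open>B\<close> of \<open>Basis\<close> selects the directions in which the upper half of the
  parent cube is taken, giving its \<open>2 ^ n\<close> congruent subcubes.
\<close>

inductive_set dyadic_cubes :: "'a::euclidean_space set \<Rightarrow> 'a set set" for Q :: "'a set" where
  top: "Q \<in> dyadic_cubes Q"
| subdivide:
    "cbox a (a + l *\<^sub>R One) \<in> dyadic_cubes Q \<Longrightarrow> l > 0 \<Longrightarrow> B \<subseteq> Basis \<Longrightarrow>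
     cbox (a + (l / 2) *\<^sub>R \<Sum>B) (a + (l / 2) *\<^sub>R \<Sum>B + (l / 2) *\<^sub>R One) \<in> dyadic_cubes Q"

definition average :: "'a::euclidean_space set \<Rightarrow> ('a \<Rightarrow> real) \<Rightarrow> real" where
  "average Q f = (1 / measure lebesgue Q) * (LINT x:Q|lebesgue. f x)"

definition locally_integrable :: "('a::euclidean_space \<Rightarrow> real) \<Rightarrow> bool" where
  "locally_integrable f \<longleftrightarrow> (\<forall>K. compact K \<longrightarrow> set_integrable lebesgue K f)"

text \<open>
  The averages are finite, but their supremum may be infinite at some points, so the maximal
  function is valued in the extended nonnegative reals.
\<close>

definition dyadic_maximal :: "'a::euclidean_space set \<Rightarrow> ('a \<Rightarrow> real) \<Rightarrow> 'a \<Rightarrow> ennreal" where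
  "dyadic_maximal Q f x =
     (SUP P\<in>dyadic_cubes Q. ennreal (average P (\<lambda>y. \<bar>f y\<bar>)) * indicator P x)"

text \<open>
  A function space over \<open>Q\<close> is given by its set \<open>X\<close> of members and its quasi-norm \<open>N\<close>.
  Members are Lebesgue measurable on \<open>Q\<close> and are identified when equal almost everywhere
  on \<open>Q\<close>: all pointwise relations are read almost everywhere, and by \<open>ideal\<close> and
  \<open>compatible\<close> both membership and quasi-norm depend only on the class of a function
  modulo null sets. In particular they depend only on the restriction of the function to \<open>Q\<close>,
  so members are represented by functions on the whole space with arbitrary values off \<open>Q\<close>.

  The constant in the quasi-triangle inequality may depend on \<open>Q\<close>. Completeness is not
  listed because it is a consequence of the Fatou property.
\<close>

locale quasi_banach_function_space =
  fixes Q :: "'a::euclidean_space set"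
    and X :: "('a \<Rightarrow> real) set"
    and N :: "('a \<Rightarrow> real) \<Rightarrow> real"
  assumes measurable: "f \<in> X \<Longrightarrow> f \<in> borel_measurable (lebesgue_on Q)"
    and zero_mem: "(\<lambda>x. 0) \<in> X"
    and add_mem: "f \<in> X \<Longrightarrow> g \<in> X \<Longrightarrow> (\<lambda>x. f x + g x) \<in> X"
    and scale_mem: "f \<in> X \<Longrightarrow> (\<lambda>x. c * f x) \<in> X"
    and ideal: "g \<in> X \<Longrightarrow> f \<in> borel_measurable (lebesgue_on Q) \<Longrightarrow>
      (AE x in lebesgue_on Q. \<bar>f x\<bar> \<le> \<bar>g x\<bar>) \<Longrightarrow> f \<in> X"
    and nonneg: "f \<in> X \<Longrightarrow> 0 \<le> N f"
    and eq_0_iff: "f \<in> X \<Longrightarrow> N f = 0 \<longleftrightarrow> (AE x in lebesgue_on Q. f x = 0)"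
    and scale: "f \<in> X \<Longrightarrow> N (\<lambda>x. c * f x) = \<bar>c\<bar> * N f"
    and quasi_triangle:
      "\<exists>K\<ge>1. \<forall>f\<in>X. \<forall>g\<in>X. N (\<lambda>x. f x + g x) \<le> K * (N f + N g)"
    and compatible: "f \<in> X \<Longrightarrow> g \<in> X \<Longrightarrow>
      (AE x in lebesgue_on Q. \<bar>f x\<bar> \<le> \<bar>g x\<bar>) \<Longrightarrow> N f \<le> N g"
    and weak_order_unit: "\<exists>f\<in>X. AE x in lebesgue_on Q. f x > 0"
    and Fatou: "(\<And>m::nat. F m \<in> X) \<Longrightarrow>
      (AE x in lebesgue_on Q. (\<forall>m. 0 \<le> F m x) \<and> incseq (\<lambda>m. F m x) \<and> (\<lambda>m. F m x) \<longlonglongrightarrow> f x) \<Longrightarrow>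
      bdd_above (range (\<lambda>m. N (F m))) \<Longrightarrow> f \<in> X \<and> N f = (SUP m. N (F m))"

definition extended_qnorm ::
  "('a \<Rightarrow> real) set \<Rightarrow> (('a \<Rightarrow> real) \<Rightarrow> real) \<Rightarrow> ('a \<Rightarrow> real) \<Rightarrow> ennreal" where
  "extended_qnorm X N f = (if f \<in> X then ennreal (N f) else \<infinity>)"

text \<open>
  For functions with values in \<open>[0, \<infinity>]\<close>: a function which is finite almost everywhere on
  \<open>Q\<close> is identified with a real-valued one, and any other function is not a member.
\<close>

definition extended_qnorm_ennreal ::
  "'a::euclidean_space set \<Rightarrow> ('a \<Rightarrow> real) set \<Rightarrow> (('a \<Rightarrow> real) \<Rightarrow> real) \<Rightarrow> ('a \<Rightarrow> ennreal) \<Rightarrow> ennreal" where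
  "extended_qnorm_ennreal Q X N g =
     (if AE x in lebesgue_on Q. g x < \<infinity> then extended_qnorm X N (\<lambda>x. enn2real (g x)) else \<infinity>)"

definition normalized_qbfs_family ::
  "('a::euclidean_space set \<Rightarrow> ('a \<Rightarrow> real) set) \<Rightarrow> ('a set \<Rightarrow> ('a \<Rightarrow> real) \<Rightarrow> real) \<Rightarrow> bool" where
  "normalized_qbfs_family X N \<longleftrightarrow>
     (\<forall>Q. is_cube Q \<longrightarrow> quasi_banach_function_space Q (X Q) (N Q)) \<and>
     (\<exists>c>0. \<exists>C>0. \<forall>Q. is_cube Q \<longrightarrow>
        ennreal c \<le> extended_qnorm (X Q) (N Q) (indicator Q) \<and>
        extended_qnorm (X Q) (N Q) (indicator Q) \<le> ennreal C)"

definition BMO_norm :: "('a::euclidean_space \<Rightarrow> real) \<Rightarrow> ennreal" where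
  "BMO_norm f = (SUP Q\<in>{Q. is_cube Q}. ennreal (average Q (\<lambda>x. \<bar>f x - average Q f\<bar>)))"

definition BMO :: "('a::euclidean_space \<Rightarrow> real) set" where
  "BMO = {f. locally_integrable f \<and> BMO_norm f < \<infinity>}"

definition BMO_X_norm ::
  "('a::euclidean_space set \<Rightarrow> ('a \<Rightarrow> real) set) \<Rightarrow> ('a set \<Rightarrow> ('a \<Rightarrow> real) \<Rightarrow> real) \<Rightarrow>
   ('a \<Rightarrow> real) \<Rightarrow> ennreal" where
  "BMO_X_norm X N f =
     (SUP Q\<in>{Q. is_cube Q}. extended_qnorm (X Q) (N Q) (\<lambda>x. f x - average Q f))"

definition BMO_X ::
  "('a::euclidean_space set \<Rightarrow> ('a \<Rightarrow> real) set) \<Rightarrow> ('a set \<Rightarrow> ('a \<Rightarrow> real) \<Rightarrow> real) \<Rightarrow>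
   ('a \<Rightarrow> real) set" where
  "BMO_X X N = {f. locally_integrable f \<and> BMO_X_norm X N f < \<infinity>}"

definition BMO_MX_norm ::
  "('a::euclidean_space set \<Rightarrow> ('a \<Rightarrow> real) set) \<Rightarrow> ('a set \<Rightarrow> ('a \<Rightarrow> real) \<Rightarrow> real) \<Rightarrow>
   ('a \<Rightarrow> real) \<Rightarrow> ennreal" where
  "BMO_MX_norm X N f =
     (SUP Q\<in>{Q. is_cube Q}.
        extended_qnorm_ennreal Q (X Q) (N Q) (dyadic_maximal Q (\<lambda>x. f x - average Q f)))"

definition BMO_MX ::
  "('a::euclidean_space set \<Rightarrow> ('a \<Rightarrow> real) set) \<Rightarrow> ('a set \<Rightarrow> ('a \<Rightarrow> real) \<Rightarrow> real) \<Rightarrow>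
   ('a \<Rightarrow> real) set" where
  "BMO_MX X N = {f. locally_integrable f \<and> BMO_MX_norm X N f < \<infinity>}"

end

theory Submission
  imports Defs
begin

text \<open>
  Since \<open>M_Q (f - \<langle>f\<rangle>_Q)\<close> is at least the mean oscillation of \<open>f\<close> on \<open>Q\<close>, the normalization of the spaces
  gives \<open>BMO_MX \<subseteq> BMO\<close>. For the rest, each of \<open>\<bar>g - \<langle>g\<rangle>_Q\<bar>\<close> and \<open>M_Q (g - \<langle>g\<rangle>_Q)\<close>, for a suitable \<open>g\<close> in \<open>BMO\<close>
  with norm at most a constant times that of \<open>f\<close>, dominates the other expression formed with \<open>f\<close>.

  For the first domination, \<open>M_Q (f - \<langle>f\<rangle>_Q)\<close> is comparable on \<open>Q\<close>, up to a bounded error, to the supremum \<open>H\<close>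
  of the averages of \<open>\<bar>f - \<langle>f\<rangle>_Q\<bar>\<close> over the cubes with lower corner \<open>x\<close> and side \<open>l / 2 ^ k\<close>, where \<open>l\<close> is
  the side of \<open>Q\<close>. This \<open>H\<close> is defined on the whole space and lies in \<open>BMO\<close>: on a given cube the scales
  larger than the cube are nearly constant, and the smaller ones are controlled by a stopping-time
  argument.
\<close>

subsection \<open>Averages over cubes and mean oscillation\<close>

text \<open>Statement (i) tests the spaces against functions on the whole space, whereas
  \<open>M_Q\<close> is tied to one cube: its extension by zero need not lie in \<open>BMO\<close>,
  since it may be unbounded at the boundary of \<open>Q\<close>. Cubes with lower corner
  \<open>x\<close> move with \<open>x\<close>, so \<open>H\<close> sees no grid and no boundary, at
  the price of an additive error when a dyadic cube is exchanged for a cube at \<open>x\<close>. The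
  second obstacle is uniformity in \<open>Q\<close>. Scaling and monotonicity are the operations on
  \<open>X Q\<close> whose constants are the same for all cubes. Each comparison is therefore made
  by one multiple of one function, and additive errors of the size of the \<open>BMO\<close> norm
  are absorbed pointwise, by balanced signs built into \<open>g\<close>. The function
  \<open>g\<close> may change with \<open>Q\<close>, but the bound on its norm does not. All
  constants depend on the dimension alone, through \<open>shift_const\<close>.\<close>

abbreviation cube :: "'a::euclidean_space \<Rightarrow> real \<Rightarrow> 'a set" where
  "cube a l \<equiv> cbox a (a + l *\<^sub>R One)"

lemma mem_cube: "x \<in> cube a l \<longleftrightarrow> (\<forall>i\<in>Basis. a \<bullet> i \<le> x \<bullet> i \<and> x \<bullet> i \<le> a \<bullet> i + l)"
  by (auto simp: mem_box inner_add_left)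

lemma measure_cube: "l \<ge> 0 \<Longrightarrow> measure lebesgue (cube a l :: 'a::euclidean_space set) = l ^ DIM('a)"
proof -
  assume "l \<ge> 0"
  then have "a \<in> cube a l" by (simp add: mem_cube)
  then have "measure lebesgue (cube a l) = (\<Prod>i\<in>Basis. (a + l *\<^sub>R One) \<bullet> i - a \<bullet> i)"
    by (subst measure_completion) (auto intro!: content_cbox')
  then show ?thesis by (simp add: inner_add_left del: measure_completion)
qed

lemma emeasure_cube:
  "l \<ge> 0 \<Longrightarrow> emeasure lebesgue (cube a l :: 'a::euclidean_space set) = ennreal (l ^ DIM('a))"
  by (simp add: emeasure_lborel_cbox_eq inner_add_left ennreal_power)

lemma locally_integrable_cube: "locally_integrable f \<Longrightarrow> set_integrable lebesgue (cbox a b) f"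
  by (auto simp: locally_integrable_def)

lemma locally_integrable_measurable:
  fixes f :: "'a::euclidean_space \<Rightarrow> real"
  assumes "locally_integrable f"
  shows "f \<in> borel_measurable lebesgue"
proof -
  have "f integrable_on cbox a b" for a b
    using assms set_lebesgue_integral_eq_integral(1) locally_integrable_cube by blast
  then have "f measurable_on UNIV" by (rule integrable_subintervals_imp_measurable)
  then show ?thesis by (simp add: measurable_on_iff_borel_measurable)
qed

lemma locally_integrableI:
  fixes f :: "'a::euclidean_space \<Rightarrow> real"
  assumes "f \<in> borel_measurable lebesgue"
    and "\<And>a l. l > 0 \<Longrightarrow> (\<integral>\<^sup>+x\<in>cube a l. ennreal \<bar>f x\<bar> \<partial>lebesgue) < \<infinity>"
  shows "locally_integrable f"
  unfolding locally_integrable_def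
proof (intro allI impI)
  fix K :: "'a set" assume K: "compact K"
  then obtain B where "B > 0" and B: "\<And>x. x \<in> K \<Longrightarrow> norm x \<le> B"
    using compact_imp_bounded bounded_pos by metis
  have sub: "K \<subseteq> cube (- B *\<^sub>R One) (2*B)"
  proof
    fix x assume "x \<in> K"
    then have "\<bar>x \<bullet> i\<bar> \<le> B" if "i \<in> Basis" for i
      using B Basis_le_norm[OF that, of x] by (meson order_trans)
    then show "x \<in> cube (- B *\<^sub>R One) (2*B)"
      unfolding mem_cube by (force simp: abs_le_iff)
  qed
  have "set_integrable lebesgue (cube (- B *\<^sub>R One) (2*B)) f"
    unfolding set_integrable_def
  proof (rule integrableI_bounded)
    have "(\<integral>\<^sup>+x. ennreal (norm (indicat_real (cube (- B *\<^sub>R One) (2*B)) x *\<^sub>R f x)) \<partial>lebesgue)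
      = (\<integral>\<^sup>+x\<in>cube (- B *\<^sub>R One) (2*B). ennreal \<bar>f x\<bar> \<partial>lebesgue)"
      by (rule nn_integral_cong) (auto split: split_indicator)
    then show "(\<integral>\<^sup>+x. ennreal (norm (indicat_real (cube (- B *\<^sub>R One) (2*B)) x *\<^sub>R f x)) \<partial>lebesgue) < \<infinity>"
      using assms(2)[of "2*B" "- B *\<^sub>R One"] \<open>B>0\<close> by simp
  qed (intro borel_measurable_scaleR borel_measurable_indicator assms(1), simp)
  then show "set_integrable lebesgue K f"
    by (rule set_integrable_subset) (use sub K in \<open>auto intro: lmeasurable_compact[THEN fmeasurableD]\<close>)
qed

lemma locally_integrable_const: "locally_integrable (\<lambda>x. c)"
  using lmeasurable_compact
  by (auto simp: locally_integrable_def set_integrable_def fmeasurable_def simp del: emeasure_completion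
      intro!: integrable_mult_left integrable_real_indicator)

lemma locally_integrable_add: "locally_integrable f \<Longrightarrow> locally_integrable g \<Longrightarrow> locally_integrable (\<lambda>x. f x + g x)"
  by (auto simp: locally_integrable_def)

lemma locally_integrable_diff: "locally_integrable f \<Longrightarrow> locally_integrable g \<Longrightarrow> locally_integrable (\<lambda>x. f x - g x)"
  by (auto simp: locally_integrable_def)

lemma locally_integrable_cmult: "locally_integrable f \<Longrightarrow> locally_integrable (\<lambda>x. c * f x)"
  by (auto simp: locally_integrable_def)

lemma locally_integrable_abs: "locally_integrable f \<Longrightarrow> locally_integrable (\<lambda>x. \<bar>f x\<bar>)"
  by (auto simp: locally_integrable_def set_integrable_abs)

lemma locally_integrable_bounded:
  fixes f :: "'a::euclidean_space \<Rightarrow> real"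
  assumes "f \<in> borel_measurable lebesgue" "\<And>x. \<bar>f x\<bar> \<le> M"
  shows "locally_integrable f"
proof (rule locally_integrableI)
  fix a :: 'a and l :: real assume "l > 0"
  have "(\<integral>\<^sup>+x\<in>cube a l. ennreal \<bar>f x\<bar> \<partial>lebesgue) \<le> (\<integral>\<^sup>+x\<in>cube a l. ennreal M \<partial>lebesgue)"
    using assms(2) by (intro nn_integral_mono mult_right_mono) (auto simp: ennreal_leI)
  also have "\<dots> < \<infinity>"
    by (subst nn_integral_cmult_indicator) (use \<open>l>0\<close> in \<open>auto simp: emeasure_cube ennreal_mult_less_top simp del: emeasure_completion\<close>)
  finally show "(\<integral>\<^sup>+x\<in>cube a l. ennreal \<bar>f x\<bar> \<partial>lebesgue) < \<infinity>" .
qed (use assms in auto)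

lemmas locally_integrable_intros =
  locally_integrable_const locally_integrable_add locally_integrable_diff locally_integrable_cmult
  locally_integrable_abs

section \<open>Averages over a fixed cube\<close>

context
  fixes Q :: "'a::euclidean_space set" and a l
  assumes l: "l > 0" and Q: "Q = cube a l"
begin

lemma measure_Q_pos: "measure lebesgue Q > 0"
  using l by (simp add: Q measure_cube del: measure_completion)

lemma average_add:
  "locally_integrable f \<Longrightarrow> locally_integrable g \<Longrightarrow> average Q (\<lambda>x. f x + g x) = average Q f + average Q g"
  unfolding average_def Q
  by (subst set_integral_add(2)) (auto simp: locally_integrable_cube algebra_simps)

lemma average_diff:
  "locally_integrable f \<Longrightarrow> locally_integrable g \<Longrightarrow> average Q (\<lambda>x. f x - g x) = average Q f - average Q g"
  unfolding average_def Q
  by (subst set_integral_diff(2)) (auto simp: locally_integrable_cube algebra_simps)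

lemma average_cmult: "average Q (\<lambda>x. c * f x) = c * average Q f"
  unfolding average_def by simp

lemma average_const: "average Q (\<lambda>x. c) = c"
  using measure_Q_pos unfolding average_def Q
  by (simp add: set_lebesgue_integral_def del: measure_completion)

lemma average_mono_AE:
  assumes "locally_integrable f" "locally_integrable g" "AE x in lebesgue. x \<in> Q \<longrightarrow> f x \<le> g x"
  shows "average Q f \<le> average Q g"
  unfolding average_def
  by (intro mult_left_mono set_integral_mono_AE) (use assms Q in \<open>auto simp: locally_integrable_cube\<close>)

lemma average_mono:
  "locally_integrable f \<Longrightarrow> locally_integrable g \<Longrightarrow> (\<And>x. x \<in> Q \<Longrightarrow> f x \<le> g x) \<Longrightarrow> average Q f \<le> average Q g"
  by (rule average_mono_AE) auto

lemma average_nonneg: "locally_integrable f \<Longrightarrow> (\<And>x. x \<in> Q \<Longrightarrow> 0 \<le> f x) \<Longrightarrow> 0 \<le> average Q f"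
  using average_mono[of "\<lambda>x. 0" f] average_const[of 0] by (simp add: locally_integrable_const)

lemma abs_average_le: "locally_integrable f \<Longrightarrow> \<bar>average Q f\<bar> \<le> average Q (\<lambda>x. \<bar>f x\<bar>)"
  using average_mono[of f "\<lambda>x. \<bar>f x\<bar>"] average_mono[of "\<lambda>x. -1 * f x" "\<lambda>x. \<bar>f x\<bar>"]
  by (simp add: average_cmult[of "-1", simplified] locally_integrable_intros
      locally_integrable_cmult[of _ "-1", simplified] abs_le_iff)

lemma abs_average_diff_le:
  "locally_integrable f \<Longrightarrow> \<bar>average Q f - c\<bar> \<le> average Q (\<lambda>x. \<bar>f x - c\<bar>)"
  using abs_average_le[of "\<lambda>x. f x - c"]
  by (simp add: average_diff average_const locally_integrable_intros)

lemma nn_integral_eq_average: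
  assumes "locally_integrable f" "\<And>x. x \<in> Q \<Longrightarrow> 0 \<le> f x"
  shows "(\<integral>\<^sup>+x\<in>Q. ennreal (f x) \<partial>lebesgue) = ennreal (l ^ DIM('a) * average Q f)"
proof -
  have "set_integrable lebesgue Q f" using assms Q by (simp add: locally_integrable_cube)
  then have "(\<integral>\<^sup>+x. ennreal (indicat_real Q x *\<^sub>R f x) \<partial>lebesgue) = ennreal (LINT x:Q|lebesgue. f x)"
    unfolding set_integrable_def set_lebesgue_integral_def
    by (intro nn_integral_eq_integral) (use assms in \<open>auto split: split_indicator\<close>)
  moreover have "(\<integral>\<^sup>+x. ennreal (indicat_real Q x *\<^sub>R f x) \<partial>lebesgue) = (\<integral>\<^sup>+x\<in>Q. ennreal (f x) \<partial>lebesgue)"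
    by (rule nn_integral_cong) (auto split: split_indicator)
  moreover have "l ^ DIM('a) * average Q f = (LINT x:Q|lebesgue. f x)"
    using l by (simp add: average_def Q measure_cube del: measure_completion)
  ultimately show ?thesis by simp
qed

lemma average_le_if_nn_integral_le:
  assumes "locally_integrable f" "\<And>x. x \<in> Q \<Longrightarrow> 0 \<le> f x" "0 \<le> B"
    "(\<integral>\<^sup>+x\<in>Q. ennreal (f x) \<partial>lebesgue) \<le> ennreal (l ^ DIM('a) * B)"
  shows "average Q f \<le> B"
proof -
  have "ennreal (l ^ DIM('a) * average Q f) \<le> ennreal (l ^ DIM('a) * B)"
    using assms(4) nn_integral_eq_average[of f, OF assms(1,2)] by simp
  then show ?thesis using l assms(3) by (subst (asm) ennreal_le_iff) auto
qed

end

text \<open>The real-valued counterpart of a bound on \<open>BMO_norm\<close>, translated in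
  \<open>BMO_norm_le_iff\<close>. An explicit \<open>b\<close> lets every later constant be tracked
  as a multiple of \<open>b\<close>.\<close>

definition osc_le :: "real \<Rightarrow> ('a::euclidean_space \<Rightarrow> real) \<Rightarrow> bool" where
  "osc_le b f \<longleftrightarrow> locally_integrable f \<and>
     (\<forall>a l. l > 0 \<longrightarrow> average (cube a l) (\<lambda>x. \<bar>f x - average (cube a l) f\<bar>) \<le> b)"

lemma osc_leD: "osc_le b f \<Longrightarrow> l > 0 \<Longrightarrow> average (cube a l) (\<lambda>x. \<bar>f x - average (cube a l) f\<bar>) \<le> b"
  and osc_le_locally_integrable: "osc_le b f \<Longrightarrow> locally_integrable f"
  by (auto simp: osc_le_def)

lemma osc_le_nonneg:
  fixes f :: "'a::euclidean_space \<Rightarrow> real"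
  assumes "osc_le b f" shows "0 \<le> b"
proof -
  have "0 \<le> average (cube (0::'a) 1) (\<lambda>x. \<bar>f x - average (cube 0 1) f\<bar>)"
    by (rule average_nonneg[OF zero_less_one refl]) (intro locally_integrable_intros osc_le_locally_integrable[OF assms] abs_ge_zero | (simp; fail) | (linarith; fail))+
  then show ?thesis using osc_leD[OF assms, of 1 0] by simp
qed

text \<open>Moving the reference value from \<open>c\<close> to the average costs the distance
  between them, which is itself at most the mean of \<open>\<bar>f x - c\<bar>\<close>; hence the
  factor 2.\<close>

lemma average_osc_le_2:
  assumes "l > 0" "locally_integrable f" "average (cube a l) (\<lambda>x. \<bar>f x - c\<bar>) \<le> b"
  shows "average (cube a l) (\<lambda>x. \<bar>f x - average (cube a l) f\<bar>) \<le> 2 * b"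
proof -
  let ?m = "average (cube a l) f"
  have "average (cube a l) (\<lambda>x. \<bar>f x - ?m\<bar>) \<le> average (cube a l) (\<lambda>x. \<bar>f x - c\<bar> + \<bar>?m - c\<bar>)"
    by (rule average_mono[OF assms(1) refl]) (auto intro!: locally_integrable_intros assms)
  also have "\<dots> = average (cube a l) (\<lambda>x. \<bar>f x - c\<bar>) + \<bar>?m - c\<bar>"
    by (subst average_add[OF assms(1) refl])
      (auto intro!: locally_integrable_intros assms simp: average_const[OF assms(1) refl])
  also have "\<dots> \<le> b + b"
    using abs_average_diff_le[OF assms(1) refl assms(2)] assms(3) by (intro add_mono) (auto intro: order_trans)
  finally show ?thesis by simp
qed

text \<open>The reference value may be chosen for each cube separately. For the maximal function the
  natural choice is not its average but a maximum of averages of \<open>v\<close>.\<close>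

lemma osc_leI:
  assumes "locally_integrable f"
    and "\<And>a l. l > 0 \<Longrightarrow> \<exists>c. average (cube a l) (\<lambda>x. \<bar>f x - c\<bar>) \<le> b"
  shows "osc_le (2 * b) f"
  unfolding osc_le_def using assms average_osc_le_2 by metis

text \<open>By the reverse triangle inequality, the distance of the average of \<open>f\<close> from
  \<open>c\<close> serves as reference value on each cube.\<close>

lemma osc_le_abs_diff:
  assumes "osc_le b f" shows "osc_le (2 * b) (\<lambda>x. \<bar>f x - c\<bar>)"
proof (rule osc_leI)
  fix a :: 'a and l :: real assume l: "l > 0"
  have "average (cube a l) (\<lambda>x. \<bar>\<bar>f x - c\<bar> - \<bar>average (cube a l) f - c\<bar>\<bar>)
     \<le> average (cube a l) (\<lambda>x. \<bar>f x - average (cube a l) f\<bar>)"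
    by (rule average_mono[OF l refl])
      (intro locally_integrable_intros osc_le_locally_integrable[OF assms] abs_ge_zero | (simp; fail) | (linarith; fail))+
  also have "\<dots> \<le> b" using osc_leD[OF assms l] .
  finally show "\<exists>d. average (cube a l) (\<lambda>x. \<bar>\<bar>f x - c\<bar> - d\<bar>) \<le> b" by blast
qed (intro locally_integrable_intros osc_le_locally_integrable[OF assms] abs_ge_zero | (simp; fail) | (linarith; fail))+

text \<open>The average of the unperturbed \<open>f\<close> is kept as reference value, so
  \<open>d\<close> is paid once before the doubling.\<close>

lemma osc_le_perturb:
  assumes "osc_le b f" "g \<in> borel_measurable lebesgue" "\<And>x. \<bar>g x - f x\<bar> \<le> d"
  shows "osc_le (2 * (b + d)) g"
proof (rule osc_leI)
  have f: "locally_integrable f" using assms(1) by (rule osc_le_locally_integrable)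
  have "locally_integrable (\<lambda>x. f x + (g x - f x))"
    by (intro locally_integrable_add f locally_integrable_bounded[of _ d])
      (use assms locally_integrable_measurable[OF f] in auto)
  then show g: "locally_integrable g" by simp
  fix a :: 'a and l :: real assume l: "l > 0"
  let ?m = "average (cube a l) f"
  have "average (cube a l) (\<lambda>x. \<bar>g x - ?m\<bar>) \<le> average (cube a l) (\<lambda>x. \<bar>f x - ?m\<bar> + d)"
  proof (rule average_mono[OF l refl])
    show "\<bar>g x - ?m\<bar> \<le> \<bar>f x - ?m\<bar> + d" for x using assms(3)[of x] by linarith
  qed (auto intro!: locally_integrable_intros f g)
  also have "\<dots> = average (cube a l) (\<lambda>x. \<bar>f x - ?m\<bar>) + d"
    by (subst average_add[OF l refl]) (auto intro!: locally_integrable_intros f simp: average_const[OF l refl])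
  also have "\<dots> \<le> b + d" using osc_leD[OF assms(1) l] by simp
  finally show "\<exists>c. average (cube a l) (\<lambda>x. \<bar>g x - c\<bar>) \<le> b + d" by blast
qed

lemma osc_le_scale:
  assumes "osc_le b f" shows "osc_le (\<bar>c\<bar> * b) (\<lambda>x. c * f x)"
  unfolding osc_le_def
proof (intro conjI allI impI)
  show "locally_integrable (\<lambda>x. c * f x)" by (intro locally_integrable_intros osc_le_locally_integrable[OF assms])
  fix a :: 'a and l :: real assume l: "l > 0"
  have "(\<lambda>x. \<bar>c * f x - average (cube a l) (\<lambda>x. c * f x)\<bar>) = (\<lambda>x. \<bar>c\<bar> * \<bar>f x - average (cube a l) f\<bar>)"
    by (auto simp: average_cmult[OF l refl] abs_mult[symmetric] algebra_simps)
  then show "average (cube a l) (\<lambda>x. \<bar>c * f x - average (cube a l) (\<lambda>x. c * f x)\<bar>) \<le> \<bar>c\<bar> * b"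
    using osc_leD[OF assms l, of a] by (simp add: average_cmult[OF l refl] mult_left_mono)
qed

text \<open>The mean over the smaller cube of the distance of \<open>f\<close> from its average on
  the larger cube is at most the volume ratio, here at most \<open>t ^ DIM('a)\<close>, times the
  mean over the larger cube.\<close>

lemma average_subcube_diff:
  fixes f :: "'a::euclidean_space \<Rightarrow> real"
  assumes "osc_le b f" "0 < r" "cube x r \<subseteq> cube a l" "l \<le> t * r"
  shows "\<bar>average (cube x r) f - average (cube a l) f\<bar> \<le> t ^ DIM('a) * b"
proof -
  have f: "locally_integrable f" using assms(1) by (rule osc_le_locally_integrable)
  \<comment> \<open>Both extreme corners of the smaller cube lie in the larger one, which forces
    \<open>l\<close> to be positive.\<close>
  have "x \<in> cube a l" "x + r *\<^sub>R One \<in> cube a l" using assms(2,3)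
    by (auto intro!: subsetD[OF assms(3)]) (auto simp: mem_cube inner_add_left)
  then have "0 < l" using \<open>0<r\<close> by (force simp: mem_cube inner_add_left SOME_Basis dest: bspec[of _ _ "SOME i. i \<in> Basis"])
  let ?m = "average (cube a l) f"
  let ?g = "\<lambda>x. \<bar>f x - ?m\<bar>"
  have "ennreal (r ^ DIM('a) * average (cube x r) ?g) = (\<integral>\<^sup>+x\<in>cube x r. ennreal (?g x) \<partial>lebesgue)"
    by (subst nn_integral_eq_average[OF assms(2) refl]) (auto intro!: locally_integrable_intros f)
  also have "\<dots> \<le> (\<integral>\<^sup>+x\<in>cube a l. ennreal (?g x) \<partial>lebesgue)"
    by (rule nn_set_integral_set_mono) fact
  also have "\<dots> = ennreal (l ^ DIM('a) * average (cube a l) ?g)"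
    by (subst nn_integral_eq_average[OF \<open>0<l\<close> refl]) (auto intro!: locally_integrable_intros f)
  finally have "r ^ DIM('a) * average (cube x r) ?g \<le> l ^ DIM('a) * average (cube a l) ?g"
    using \<open>0<l\<close> by (subst (asm) ennreal_le_iff) (auto intro!: mult_nonneg_nonneg average_nonneg[OF \<open>0<l\<close> refl] locally_integrable_intros f)
  also have "\<dots> \<le> (t * r) ^ DIM('a) * b"
    using osc_leD[OF assms(1) \<open>0<l\<close>] assms \<open>0<l\<close> osc_le_nonneg[OF assms(1)]
    by (intro mult_mono power_mono average_nonneg[OF \<open>0<l\<close> refl]) (auto intro!: locally_integrable_intros f)
  finally have "average (cube x r) ?g \<le> t ^ DIM('a) * b"
    using \<open>0<r\<close> by (simp add: power_mult_distrib mult.assoc mult.left_commute[of _ "r ^ _"])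
  then show ?thesis using abs_average_diff_le[OF assms(2) refl f, of x ?m] by simp
qed

text \<open>Two overlapping cubes of sides \<open>l\<close> and at least \<open>l / 2\<close> lie in a cube of side \<open>2 * l\<close>, so each comparison costs \<open>4 ^ n\<close>.\<close>
definition shift_const :: "'a::euclidean_space itself \<Rightarrow> real" where
  "shift_const _ = 2 * 4 ^ DIM('a)"

text \<open>Used in two ways: to exchange a dyadic cube containing \<open>x\<close> for the cube of
  the same side with lower corner \<open>x\<close>, and to show that averages at scales above a
  given cube hardly vary with \<open>x\<close> in that cube. The enclosing cube is
  \<open>cube a (2*l)\<close>, and \<open>2 * l \<le> 4 * r\<close>.\<close>

lemma average_shifted_cube_diff:
  fixes f :: "'a::euclidean_space \<Rightarrow> real"
  assumes "osc_le b f" "x \<in> cube a l" "0 < l" "l / 2 \<le> r" "r \<le> l"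
  shows "\<bar>average (cube x r) f - average (cube a l) f\<bar> \<le> shift_const TYPE('a) * b"
proof -
  have "\<bar>average (cube x r) f - average (cube a (2*l)) f\<bar> \<le> 4 ^ DIM('a) * b"
    by (rule average_subcube_diff[OF assms(1)]) (use assms in \<open>force simp: mem_cube\<close>)+
  moreover have "\<bar>average (cube a l) f - average (cube a (2*l)) f\<bar> \<le> 4 ^ DIM('a) * b"
    by (rule average_subcube_diff[OF assms(1)]) (use assms in \<open>force simp: mem_cube\<close>)+
  ultimately show ?thesis by (simp add: shift_const_def)
qed

subsection \<open>Halving cubes and differentiation of averages\<close>

lemma average_eq_integral:
  fixes f :: "'a::euclidean_space \<Rightarrow> real"
  assumes "locally_integrable f" "r \<ge> 0"
  shows "average (cube x r) f = integral (cube x r) f / r ^ DIM('a)"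
  using assms by (simp add: average_def measure_cube locally_integrable_cube
      set_lebesgue_integral_eq_integral(2) del: measure_completion)

text \<open>An indefinite integral is continuous in both corners of the box. This gives the
  measurability of suprema over countably many side lengths.\<close>

lemma average_continuous:
  fixes f :: "'a::euclidean_space \<Rightarrow> real"
  assumes f: "locally_integrable f" and r: "r > 0"
  shows "continuous_on UNIV (\<lambda>x. average (cube x r) f)"
proof -
  have "continuous_on UNIV (\<lambda>x. integral (cube x r) f)"
    unfolding continuous_on_iff
  proof (intro ballI allI impI)
    fix x :: 'a and e :: real assume e: "0 < e"
    define u where "u = x - One"
    define v where "v = x + (r + 1) *\<^sub>R One"
    have "f integrable_on cbox u v"
      using f locally_integrable_cube set_lebesgue_integral_eq_integral(1) by blast
    moreover have "x \<in> cbox u v" "x + r *\<^sub>R One \<in> cbox u v"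
      using r by (auto simp: u_def v_def mem_box inner_diff_left inner_add_left)
    ultimately obtain d where d: "d > 0"
      and dd: "\<And>c' d'. c' \<in> cbox u v \<Longrightarrow> d' \<in> cbox u v \<Longrightarrow> norm (c' - x) \<le> d \<Longrightarrow> norm (d' - (x + r *\<^sub>R One)) \<le> d
         \<Longrightarrow> norm (integral (cbox c' d') f - integral (cbox x (x + r *\<^sub>R One)) f) < e"
      using e indefinite_integral_continuous[of f u v x "x + r *\<^sub>R One" e] by metis
    show "\<exists>d>0. \<forall>y\<in>UNIV. dist y x < d \<longrightarrow> dist (integral (cube y r) f) (integral (cube x r) f) < e"
    proof (intro exI[of _ "min d 1"] conjI ballI impI)
      fix y assume y: "dist y x < min d 1"
      have *: "\<bar>y \<bullet> i - x \<bullet> i\<bar> < 1" if "i \<in> Basis" for i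
        using y Basis_le_norm[OF that, of "y - x"] by (auto simp: dist_norm inner_diff_left)
      have "y \<in> cbox u v" "y + r *\<^sub>R One \<in> cbox u v"
        using r by (auto simp: u_def v_def mem_box inner_diff_left inner_add_left dest!: *)
      then show "dist (integral (cube y r) f) (integral (cube x r) f) < e"
        unfolding dist_norm using y by (intro dd) (auto simp: dist_norm)
    qed (use d in auto)
  qed
  then have "continuous_on UNIV (\<lambda>x. integral (cube x r) f / r ^ DIM('a))"
    using r by (intro continuous_intros) auto
  then show ?thesis using f r by (simp add: average_eq_integral)
qed

lemma average_borel_measurable:
  fixes f :: "'a::euclidean_space \<Rightarrow> real"
  assumes "locally_integrable f" "r > 0"
  shows "(\<lambda>x. average (cube x r) f) \<in> borel_measurable lebesgue"
  using borel_measurable_continuous_onI[OF average_continuous[OF assms]] by (simp add: measurable_completion)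

text \<open>Lebesgue differentiation in one-sided form: \<open>x\<close> is the lower corner of the
  shrinking cubes, which matches the cubes used in \<open>local_maximal\<close>.\<close>

lemma AE_average_tendsto:
  fixes f :: "'a::euclidean_space \<Rightarrow> real"
  assumes f: "locally_integrable f" and l: "l > 0"
  shows "AE x in lebesgue. (\<lambda>k. average (cube x (l / 2 ^ k)) f) \<longlonglongrightarrow> f x"
proof -
  have "f integrable_on cbox a b" for a b
    using f locally_integrable_cube set_lebesgue_integral_eq_integral(1) by blast
  then obtain Z where Z: "negligible Z" and
    diff: "\<And>x e. x \<notin> Z \<Longrightarrow> 0 < e \<Longrightarrow>
      \<exists>d>0. \<forall>h. 0 < h \<and> h < d \<longrightarrow> norm (integral (cube x h) f /\<^sub>R h ^ DIM('a) - f x) < e"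
    using integrable_ccontinuous_explicit[of f] by metis
  have "(\<lambda>k. average (cube x (l / 2 ^ k)) f) \<longlonglongrightarrow> f x" if xZ: "x \<notin> Z" for x
  proof (rule LIMSEQ_I)
    fix e :: real assume "0 < e"
    then obtain d where "d > 0" and d: "\<And>h. 0 < h \<Longrightarrow> h < d \<Longrightarrow> norm (average (cube x h) f - f x) < e"
      using diff[OF xZ, of e] f by (auto simp: average_eq_integral divide_inverse mult.commute)
    have "(\<lambda>k. l * (1 / 2) ^ k) \<longlonglongrightarrow> l * 0" by (intro tendsto_intros LIMSEQ_power_zero) auto
    then have "eventually (\<lambda>k. l * (1 / 2) ^ k < d) sequentially"
      using \<open>d>0\<close> by (intro order_tendstoD(2)) auto
    then obtain K where "\<And>k. k \<ge> K \<Longrightarrow> l / 2 ^ k < d"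
      by (auto simp: eventually_sequentially power_divide)
    then show "\<exists>K. \<forall>k\<ge>K. norm (average (cube x (l / 2 ^ k)) f - f x) < e"
      using d l by (intro exI[of _ K]) auto
  qed
  then show ?thesis using Z by (intro AE_I'[of Z]) (auto simp: negligible_iff_null_sets)
qed

section \<open>Splitting a cube into its congruent subcubes\<close>

lemma inner_sum_Basis:
  assumes "B \<subseteq> Basis" "i \<in> Basis"
  shows "(\<Sum>B) \<bullet> i = (if i \<in> B then 1 else 0 :: real)"
proof -
  have "finite B" using assms(1) finite_Basis finite_subset by blast
  have "(\<Sum>B) \<bullet> i = (\<Sum>j\<in>B. if j = i then 1 else 0)"
    using assms by (auto simp: inner_sum_left inner_Basis intro!: sum.cong)
  then show ?thesis using \<open>finite B\<close> by simp
qed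

lemma mem_halving:
  fixes a :: "'a::euclidean_space"
  assumes "B \<subseteq> Basis"
  shows "x \<in> cube (a + (l / 2) *\<^sub>R \<Sum>B) (l / 2) \<longleftrightarrow>
    (\<forall>i\<in>Basis. if i \<in> B then a \<bullet> i + l / 2 \<le> x \<bullet> i \<and> x \<bullet> i \<le> a \<bullet> i + l
       else a \<bullet> i \<le> x \<bullet> i \<and> x \<bullet> i \<le> a \<bullet> i + l / 2)"
  unfolding mem_cube
  by (intro ball_cong refl) (simp only: inner_add_left inner_scaleR_left inner_sum_Basis[OF assms], simp add: add.commute)

lemma halving_cover:
  fixes a :: "'a::euclidean_space"
  assumes "l > 0" "x \<in> cube a l"
  obtains B where "B \<subseteq> Basis" "x \<in> cube (a + (l / 2) *\<^sub>R \<Sum>B) (l / 2)"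
proof
  let ?B = "{i\<in>Basis. x \<bullet> i > a \<bullet> i + l / 2}"
  show B: "?B \<subseteq> Basis" by auto
  show "x \<in> cube (a + (l / 2) *\<^sub>R \<Sum>?B) (l / 2)"
    unfolding mem_halving[OF B] using assms(2) unfolding mem_cube by simp
qed

lemma halving_subset:
  fixes a :: "'a::euclidean_space"
  assumes "l > 0" "B \<subseteq> Basis"
  shows "cube (a + (l / 2) *\<^sub>R \<Sum>B) (l / 2) \<subseteq> cube a l"
proof
  fix x assume "x \<in> cube (a + (l / 2) *\<^sub>R \<Sum>B) (l / 2)"
  note x = bspec[OF this[unfolded mem_halving[OF assms(2)]]]
  show "x \<in> cube a l"
    unfolding mem_cube
  proof
    fix i :: 'a assume i: "i \<in> Basis"
    show "a \<bullet> i \<le> x \<bullet> i \<and> x \<bullet> i \<le> a \<bullet> i + l"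
      using x[OF i] assms(1) by (simp split: if_splits)
  qed
qed

text \<open>The closed subcubes overlap only on the midpoint hyperplanes, which are negligible; off
  these, \<open>x\<close> determines the set \<open>B\<close> of directions in which it lies in the
  upper half.\<close>

lemma AE_sum_indicator_halving:
  fixes a :: "'a::euclidean_space"
  assumes l: "l > 0"
  shows "AE x in lebesgue. (\<Sum>B\<in>Pow Basis. indicator (cube (a + (l / 2) *\<^sub>R \<Sum>B) (l / 2)) x)
    = (indicator (cube a l) x :: ennreal)"
proof -
  have "AE x in lebesgue. \<forall>i\<in>Basis. x \<bullet> i \<noteq> a \<bullet> i + l / 2"
  proof (rule AE_finite_allI[OF finite_Basis])
    fix i :: 'a assume "i \<in> Basis"
    then have "negligible {x. x \<bullet> i = a \<bullet> i + l / 2}" by (rule negligible_standard_hyperplane)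
    then show "AE x in lebesgue. x \<bullet> i \<noteq> a \<bullet> i + l / 2"
      by (intro AE_I'[of "{x. x \<bullet> i = a \<bullet> i + l / 2}"]) (auto simp: negligible_iff_null_sets)
  qed
  then show ?thesis
  proof (eventually_elim)
    case (elim x)
    show ?case
    proof (cases "x \<in> cube a l")
      case True
      then obtain B0 where B0: "B0 \<subseteq> Basis" "x \<in> cube (a + (l / 2) *\<^sub>R \<Sum>B0) (l / 2)"
        using halving_cover[OF l] by metis
      have uniq: "B = B0" if B: "B \<subseteq> Basis" and x: "x \<in> cube (a + (l / 2) *\<^sub>R \<Sum>B) (l / 2)" for B
      proof -
        have "i \<in> B \<longleftrightarrow> x \<bullet> i > a \<bullet> i + l / 2" if "i \<in> Basis" for i
          using bspec[OF x[unfolded mem_halving[OF B]] that] bspec[OF elim that] by (auto split: if_splits)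
        moreover have "i \<in> B0 \<longleftrightarrow> x \<bullet> i > a \<bullet> i + l / 2" if "i \<in> Basis" for i
          using bspec[OF B0(2)[unfolded mem_halving[OF B0(1)]] that] bspec[OF elim that] by (auto split: if_splits)
        ultimately show ?thesis using B B0 by blast
      qed
      have "(\<Sum>B\<in>Pow Basis. indicator (cube (a + (l / 2) *\<^sub>R \<Sum>B) (l / 2)) x) = 
         (\<Sum>B\<in>Pow Basis. if B = B0 then 1 else (0::ennreal))"
      proof (intro sum.cong refl)
        fix B :: "'a set" assume "B \<in> Pow Basis"
        then have "x \<in> cube (a + (l / 2) *\<^sub>R \<Sum>B) (l / 2) \<longleftrightarrow> B = B0"
          using B0(2) uniq by blast
        then show "indicator (cube (a + (l / 2) *\<^sub>R \<Sum>B) (l / 2)) x = (if B = B0 then 1 else (0::ennreal))"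
          by (simp only: indicator_def of_bool_def)
      qed
      also have "\<dots> = 1" using B0(1) by simp
      finally show ?thesis by (simp only: indicator_simps(1)[OF True])
    next
      case False
      then have "indicator (cube (a + (l / 2) *\<^sub>R \<Sum>B) (l / 2)) x = (0::ennreal)" if "B \<in> Pow Basis" for B
      proof -
        have "cube (a + (l / 2) *\<^sub>R \<Sum>B) (l / 2) \<subseteq> cube a l"
          by (rule halving_subset) (use l that in auto)
        then have "x \<notin> cube (a + (l / 2) *\<^sub>R \<Sum>B) (l / 2)" using False by blast
        then show ?thesis by (rule indicator_simps(2))
      qed
      then have "(\<Sum>B\<in>Pow Basis. indicator (cube (a + (l / 2) *\<^sub>R \<Sum>B) (l / 2)) x) = (0::ennreal)"
        by (rule sum.neutral[OF ballI])
      then show ?thesis by (simp only: indicator_simps(2)[OF False])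
    qed
  qed
qed

lemma nn_integral_halving:
  fixes g :: "'a::euclidean_space \<Rightarrow> ennreal"
  assumes l: "l > 0" and g: "g \<in> borel_measurable lebesgue"
  shows "(\<integral>\<^sup>+x\<in>cube a l. g x \<partial>lebesgue) =
     (\<Sum>B\<in>Pow Basis. \<integral>\<^sup>+x\<in>cube (a + (l / 2) *\<^sub>R \<Sum>B) (l / 2). g x \<partial>lebesgue)"
proof -
  have "(\<integral>\<^sup>+x\<in>cube a l. g x \<partial>lebesgue) =
    (\<integral>\<^sup>+x. (\<Sum>B\<in>Pow Basis. g x * indicator (cube (a + (l / 2) *\<^sub>R \<Sum>B) (l / 2)) x) \<partial>lebesgue)"
    by (rule nn_integral_cong_AE) (use AE_sum_indicator_halving[OF l, of a] in eventually_elim, simp only: sum_distrib_left[symmetric])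
  also have "\<dots> = (\<Sum>B\<in>Pow Basis. \<integral>\<^sup>+x\<in>cube (a + (l / 2) *\<^sub>R \<Sum>B) (l / 2). g x \<partial>lebesgue)"
    by (rule nn_integral_sum) (intro borel_measurable_times_ennreal g borel_measurable_indicator, simp)
  finally show ?thesis .
qed

subsection \<open>One-sided local maximal functions\<close>

lemma two_mult_ennreal: "2 * ennreal x = ennreal (2 * x)"
  by (simp add: ennreal_mult')

text \<open>
  Induction on the number of scales. While the mean oscillation of \<open>f\<close> about \<open>c\<close> on the cube is at
  most \<open>2 * b\<close>, the largest scale contributes nothing and the cube is halved; otherwise \<open>c\<close> is
  replaced by the average of \<open>f\<close>, and the cost of doing so is absorbed since
  \<open>2 * b\<close> is at most the mean oscillation.
\<close>
lemma nn_integral_local_maximal_scales: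
  fixes f :: "'a::euclidean_space \<Rightarrow> real"
  assumes f: "osc_le b f" and D: "countable D" and l: "l > 0"
  defines "K \<equiv> (shift_const TYPE('a) + 2) * b"
  shows "(\<integral>\<^sup>+x\<in>cube a l. (SUP r\<in>D \<inter> {l / 2 ^ m<..l}. ennreal (average (cube x r) f - c - K)) \<partial>lebesgue)
     \<le> 2 * (\<integral>\<^sup>+x\<in>cube a l. ennreal \<bar>f x - c\<bar> \<partial>lebesgue)"
  using l
proof (induction m arbitrary: a l c)
  case 0
  \<comment> \<open>For \<open>m = 0\<close> the range of scales is empty, and the supremum of the
    empty set is 0.\<close>
  then show ?case by (simp add: bot_ennreal)
next
  case (Suc m)
  note l = \<open>l > 0\<close>
  have fl: "locally_integrable f" using f by (rule osc_le_locally_integrable)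
  have fm: "f \<in> borel_measurable lebesgue" using fl by (rule locally_integrable_measurable)
  have meas: "(\<lambda>x. (SUP r\<in>D \<inter> {s<..t}. ennreal (average (cube x r) f - c - K))) \<in> borel_measurable lebesgue"
    if "s \<ge> 0" for s t c
    using that D by (intro borel_measurable_SUP measurable_compose[OF _ measurable_ennreal] borel_measurable_diff
        average_borel_measurable fl) auto
  let ?I = "\<lambda>c. \<integral>\<^sup>+x\<in>cube a l. (SUP r\<in>D \<inter> {l / 2 ^ Suc m<..l}. ennreal (average (cube x r) f - c - K)) \<partial>lebesgue"
  let ?J = "\<lambda>c. \<integral>\<^sup>+x\<in>cube a l. ennreal \<bar>f x - c\<bar> \<partial>lebesgue"
  have J: "?J c = ennreal (l ^ DIM('a) * average (cube a l) (\<lambda>x. \<bar>f x - c\<bar>))" for c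
    by (subst nn_integral_eq_average[OF l refl]) (auto intro!: locally_integrable_intros fl)
  have b: "b \<ge> 0" using f by (rule osc_le_nonneg)
  have *: "?I c \<le> 2 * ?J c" if c: "average (cube a l) (\<lambda>x. \<bar>f x - c\<bar>) \<le> 2 * b" for c
  proof -
    have "(SUP r\<in>D \<inter> {l / 2 ^ Suc m<..l}. ennreal (average (cube x r) f - c - K))
      \<le> (SUP r\<in>D \<inter> {(l / 2) / 2 ^ m<..l / 2}. ennreal (average (cube x r) f - c - K))"
      if x: "x \<in> cube a l" for x
    proof (rule SUP_least)
      fix r assume r: "r \<in> D \<inter> {l / 2 ^ Suc m<..l}"
      show "ennreal (average (cube x r) f - c - K)
        \<le> (SUP r\<in>D \<inter> {(l / 2) / 2 ^ m<..l / 2}. ennreal (average (cube x r) f - c - K))"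
      proof (cases "r \<le> l / 2")
        case True
        with r show ?thesis by (intro SUP_upper) auto
      next
        case False
        then have "\<bar>average (cube x r) f - average (cube a l) f\<bar> \<le> shift_const TYPE('a) * b"
          using r by (intro average_shifted_cube_diff f x l) auto
        moreover have "\<bar>average (cube a l) f - c\<bar> \<le> 2 * b"
          using abs_average_diff_le[OF l refl fl, of a c] c by simp
        \<comment> \<open>This determines \<open>K\<close>: \<open>shift_const\<close> times
          \<open>b\<close> for moving the cube, plus \<open>2 * b\<close> for the distance of the
          average from \<open>c\<close>.\<close>
        ultimately have "average (cube x r) f - c - K \<le> 0" by (simp add: K_def algebra_simps)
        then show ?thesis by (simp add: ennreal_neg)
      qed
    qed
    then have "?I c \<le> (\<integral>\<^sup>+x\<in>cube a l. (SUP r\<in>D \<inter> {(l / 2) / 2 ^ m<..l / 2}. ennreal (average (cube x r) f - c - K)) \<partial>lebesgue)"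
      by (intro nn_integral_mono) (auto split: split_indicator)
    also have "\<dots> = (\<Sum>B\<in>Pow Basis. \<integral>\<^sup>+x\<in>cube (a + (l / 2) *\<^sub>R \<Sum>B) (l / 2).
       (SUP r\<in>D \<inter> {(l / 2) / 2 ^ m<..l / 2}. ennreal (average (cube x r) f - c - K)) \<partial>lebesgue)"
      using l by (intro nn_integral_halving meas) auto
    also have "\<dots> \<le> (\<Sum>B\<in>Pow Basis. 2 * (\<integral>\<^sup>+x\<in>cube (a + (l / 2) *\<^sub>R \<Sum>B) (l / 2). ennreal \<bar>f x - c\<bar> \<partial>lebesgue))"
      using l by (intro sum_mono Suc.IH) auto
    also have "\<dots> = 2 * ?J c"
      by (subst nn_integral_halving[OF l]) (use fm in \<open>auto simp: sum_distrib_left\<close>)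
    finally show ?thesis .
  qed
  show ?case
  proof (cases "average (cube a l) (\<lambda>x. \<bar>f x - c\<bar>) \<le> 2 * b")
    case True
    then show ?thesis by (rule *)
  next
    case False
    \<comment> \<open>Here \<open>*\<close> is applied on the same cube with \<open>?d\<close> for
      \<open>c\<close>. It gives \<open>2 * ?J ?d\<close>, at most one copy of \<open>?J c\<close>;
      the constant \<open>\<bar>?d - c\<bar>\<close> costs a second copy. The total is again
      \<open>2 * ?J c\<close>, so the factor does not grow with the number of scales.\<close>
    let ?d = "average (cube a l) f"
    have osc: "average (cube a l) (\<lambda>x. \<bar>f x - ?d\<bar>) \<le> b" using f l by (rule osc_leD)
    then have "average (cube a l) (\<lambda>x. \<bar>f x - ?d\<bar>) \<le> 2 * b" using b by simp
    then have I: "?I ?d \<le> 2 * ?J ?d" by (rule *)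
    have le: "2 * average (cube a l) (\<lambda>x. \<bar>f x - ?d\<bar>) \<le> average (cube a l) (\<lambda>x. \<bar>f x - c\<bar>)"
      using mult_left_mono[OF osc, of 2] False by simp
    have "2 * ?J ?d = ennreal (l ^ DIM('a) * (2 * average (cube a l) (\<lambda>x. \<bar>f x - ?d\<bar>)))"
      unfolding J two_mult_ennreal mult.left_commute[of 2 "l ^ DIM('a)"] by (rule refl)
    also have "\<dots> \<le> ?J c"
      unfolding J using le l by (intro ennreal_leI mult_left_mono) auto
    finally have J2: "2 * ?J ?d \<le> ?J c" .
    have "(\<integral>\<^sup>+x\<in>cube a l. ennreal \<bar>?d - c\<bar> \<partial>lebesgue) = ennreal (l ^ DIM('a) * \<bar>?d - c\<bar>)"
      using l by (subst nn_integral_eq_average[OF l refl]) (auto intro!: locally_integrable_intros simp: average_const[OF l refl])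
    also have "\<dots> \<le> ?J c"
      unfolding J using l abs_average_diff_le[OF l refl fl, of a c] by (intro ennreal_leI mult_left_mono) auto
    finally have 2: "(\<integral>\<^sup>+x\<in>cube a l. ennreal \<bar>?d - c\<bar> \<partial>lebesgue) \<le> ?J c" .
    have "?I c \<le> (\<integral>\<^sup>+x\<in>cube a l. ennreal \<bar>?d - c\<bar> +
       (SUP r\<in>D \<inter> {l / 2 ^ Suc m<..l}. ennreal (average (cube x r) f - ?d - K)) \<partial>lebesgue)"
    proof (intro nn_integral_mono mult_right_mono SUP_least)
      fix x r assume r: "r \<in> D \<inter> {l / 2 ^ Suc m<..l}"
      have "ennreal (average (cube x r) f - c - K) \<le> ennreal (\<bar>?d - c\<bar> + max 0 (average (cube x r) f - ?d - K))"
        by (intro ennreal_leI) linarith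
      also have "\<dots> = ennreal \<bar>?d - c\<bar> + ennreal (average (cube x r) f - ?d - K)"
        by (subst ennreal_plus) (auto simp: max_def ennreal_neg)
      also have "\<dots> \<le> ennreal \<bar>?d - c\<bar> +
       (SUP r\<in>D \<inter> {l / 2 ^ Suc m<..l}. ennreal (average (cube x r) f - ?d - K))"
        by (intro add_left_mono SUP_upper r)
      finally show "ennreal (average (cube x r) f - c - K) \<le> ennreal \<bar>?d - c\<bar> +
       (SUP r\<in>D \<inter> {l / 2 ^ Suc m<..l}. ennreal (average (cube x r) f - ?d - K))" .
    qed auto
    also have "\<dots> = (\<integral>\<^sup>+x\<in>cube a l. ennreal \<bar>?d - c\<bar> \<partial>lebesgue) + ?I ?d"
      by (rule nn_set_integral_add) (use l in \<open>auto intro!: meas\<close>)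
    also have "\<dots> \<le> ?J c + ?J c"
      by (rule add_mono[OF 2 order_trans[OF I J2]])
    finally show ?thesis by (simp only: mult_2)
  qed
qed

text \<open>The bound for finitely many generations of scales is independent of \<open>m\<close>, so
  monotone convergence removes the lower cutoff.\<close>

lemma nn_integral_local_maximal:
  fixes f :: "'a::euclidean_space \<Rightarrow> real"
  assumes f: "osc_le b f" and D: "countable D" "\<And>r. r \<in> D \<Longrightarrow> r > 0" and l: "l > 0"
  defines "K \<equiv> (shift_const TYPE('a) + 2) * b"
  shows "(\<integral>\<^sup>+x\<in>cube a l. (SUP r\<in>D \<inter> {..l}. ennreal (average (cube x r) f - c - K)) \<partial>lebesgue)
     \<le> 2 * (\<integral>\<^sup>+x\<in>cube a l. ennreal \<bar>f x - c\<bar> \<partial>lebesgue)"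
proof -
  have fl: "locally_integrable f" using f by (rule osc_le_locally_integrable)
  let ?S = "\<lambda>m x. (SUP r\<in>D \<inter> {l / 2 ^ m<..l}. ennreal (average (cube x r) f - c - K)) * indicator (cube a l) x"
  have "D \<inter> {..l} \<subseteq> (\<Union>m. D \<inter> {l / 2 ^ m<..l})"
  proof safe
    fix r assume r: "r \<in> D" "r \<le> l"
    obtain m where "l / r < 2 ^ m" using real_arch_pow[of 2 "l / r"] by auto
    then show "r \<in> (\<Union>m. D \<inter> {l / 2 ^ m<..l})"
      using r D(2)[OF r(1)] by (auto simp: field_simps intro!: exI[of _ m])
  qed
  then have D_eq: "D \<inter> {..l} = (\<Union>m. D \<inter> {l / 2 ^ m<..l})" by auto
  have "(\<integral>\<^sup>+x\<in>cube a l. (SUP r\<in>D \<inter> {..l}. ennreal (average (cube x r) f - c - K)) \<partial>lebesgue)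
     = (\<integral>\<^sup>+x. (SUP m. ?S m x) \<partial>lebesgue)"
    unfolding D_eq SUP_UNION SUP_mult_right_ennreal by (rule refl)
  also have "\<dots> = (SUP m. integral\<^sup>N lebesgue (?S m))"
  proof (rule nn_integral_monotone_convergence_SUP)
    show "incseq ?S"
    proof (intro incseq_SucI le_funI mult_right_mono SUP_subset_mono)
      show "D \<inter> {l / 2 ^ m<..l} \<subseteq> D \<inter> {l / 2 ^ Suc m<..l}" for m
      proof -
        have "l / 2 ^ Suc m \<le> l / 2 ^ m" using l by (intro divide_left_mono) auto
        then show ?thesis by auto
      qed
    qed auto
    show "?S m \<in> borel_measurable lebesgue" for m
      using D(1) D(2) by (intro borel_measurable_times_ennreal borel_measurable_SUP measurable_compose[OF _ measurable_ennreal]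
          borel_measurable_diff average_borel_measurable fl borel_measurable_indicator) auto
  qed
  also have "\<dots> \<le> 2 * (\<integral>\<^sup>+x\<in>cube a l. ennreal \<bar>f x - c\<bar> \<partial>lebesgue)"
    unfolding K_def by (intro SUP_least nn_integral_local_maximal_scales f D l)
  finally show ?thesis .
qed

text \<open>The absolute value is not part of the definition, since it is applied to functions that
  are already nonnegative. The side lengths are those of the dyadic cubes of a cube of side
  \<open>l\<close>, so every such cube has a counterpart at \<open>x\<close>.\<close>

definition local_maximal :: "real \<Rightarrow> ('a::euclidean_space \<Rightarrow> real) \<Rightarrow> 'a \<Rightarrow> ennreal" where
  "local_maximal l f x = (SUP k::nat. ennreal (average (cube x (l / 2 ^ k)) f))"

lemma local_maximal_measurable:
  "locally_integrable f \<Longrightarrow> l > 0 \<Longrightarrow> local_maximal l f \<in> borel_measurable lebesgue"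
  unfolding local_maximal_def[abs_def]
  by (intro borel_measurable_SUP measurable_compose[OF _ measurable_ennreal] average_borel_measurable) auto

lemma AE_le_local_maximal:
  fixes f :: "'a::euclidean_space \<Rightarrow> real"
  assumes "locally_integrable f" "l > 0"
  shows "AE x in lebesgue. ennreal (f x) \<le> local_maximal l f x"
  using AE_average_tendsto[OF assms]
proof eventually_elim
  case (elim x)
  from tendsto_ennrealI[OF elim] show ?case
    by (rule LIMSEQ_le_const2) (auto simp: local_maximal_def intro!: SUP_upper)
qed

text \<open>Ensures that the maximum over the scales above a given cube, used as reference value
  below, is attained.\<close>

lemma finite_halvings_greater:
  fixes l s :: real
  assumes "s > 0"
  shows "finite (range (\<lambda>k. l / 2 ^ k) \<inter> {s<..})"
proof -
  obtain m where m: "l / s < 2 ^ m" using real_arch_pow[of 2 "l / s"] by auto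
  have "range (\<lambda>k. l / 2 ^ k) \<inter> {s<..} \<subseteq> (\<lambda>k. l / 2 ^ k) ` {..m}"
  proof clarsimp
    fix k assume "s < l / 2 ^ k"
    then have "2 ^ k * s < l" by (simp add: field_simps)
    also have "l < 2 ^ m * s" using m assms by (simp add: field_simps)
    finally have "k \<le> m" using assms by simp
    then show "l / 2 ^ k \<in> (\<lambda>k. l / 2 ^ k) ` {..m}" by auto
  qed
  then show ?thesis using finite_surj[of "{..m}"] by auto
qed

text \<open>On \<open>cube a s\<close> the scales above \<open>s\<close> are frozen at the corner
  \<open>a\<close> up to \<open>S * b\<close>, while those up to \<open>s\<close> exceed
  \<open>m + K\<close> by at most \<open>W\<close>, whose integral is controlled. So
  \<open>h\<close> lies below \<open>c + K + W\<close> and, almost everywhere, above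
  \<open>c - K - \<bar>v - m\<bar>\<close>. The clause for \<open>s = l\<close> later bounds the
  average of \<open>h\<close> on \<open>Q\<close> itself.\<close>

lemma local_maximal_oscillation:
  fixes v :: "'a::euclidean_space \<Rightarrow> real"
  assumes v: "osc_le b v" and nonneg: "\<And>x. 0 \<le> v x" and l: "l > 0" and s: "s > 0"
  defines "h \<equiv> \<lambda>x. enn2real (local_maximal l v x)"
  shows "\<exists>c. (s = l \<longrightarrow> c = average (cube a s) v) \<and>
      (\<integral>\<^sup>+x\<in>cube a s. ennreal \<bar>h x - c\<bar> \<partial>lebesgue) \<le> ennreal (s ^ DIM('a) * ((shift_const TYPE('a) + 5) * b))"
    and "AE x in lebesgue. x \<in> cube a s \<longrightarrow> local_maximal l v x < \<infinity>"
proof -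
  define S where "S = shift_const TYPE('a)"
  define D where "D = range (\<lambda>k. l / 2 ^ k)"
  define m where "m = average (cube a s) v"
  define K where "K = (S + 2) * b"
  define W where "W x = (SUP r\<in>D \<inter> {..s}. ennreal (average (cube x r) v - m - K))" for x
  \<comment> \<open>The value \<open>m\<close> stands for the scales up to \<open>s\<close>, which
    vary around the average of \<open>v\<close> on the cube; it also makes the set nonempty when no
    scale exceeds \<open>s\<close>.\<close>
  let ?C = "insert m ((\<lambda>r. average (cube a r) v) ` (D \<inter> {s<..}))"
  define c where "c = Max ?C"
  have vl: "locally_integrable v" using v by (rule osc_le_locally_integrable)
  have b: "b \<ge> 0" using v by (rule osc_le_nonneg)
  have S: "S \<ge> 0" by (simp add: S_def shift_const_def)
  have K: "0 \<le> K" "S * b \<le> K" using S b by (auto simp: K_def algebra_simps)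
  have Dpos: "r > 0" if "r \<in> D" for r using that l by (auto simp: D_def)
  have fin: "finite ?C" using finite_halvings_greater[OF s] by (simp add: D_def)
  have c_in: "c \<in> ?C" unfolding c_def using fin by (intro Max_in) auto
  have c_ge: "d \<le> c" if "d \<in> ?C" for d unfolding c_def using fin that by (rule Max_ge)
  have m0: "0 \<le> m" unfolding m_def using nonneg by (intro average_nonneg[OF s refl] vl) auto
  have c0: "0 \<le> c" using m0 c_ge[of m] by simp
  have W_meas: "W \<in> borel_measurable lebesgue"
    unfolding W_def[abs_def]
    by (intro borel_measurable_SUP measurable_compose[OF _ measurable_ennreal] borel_measurable_diff
          average_borel_measurable vl) (auto simp: D_def l)
  have big: "\<bar>average (cube x r) v - average (cube a r) v\<bar> \<le> S * b"
    if "x \<in> cube a s" "r \<in> D" "s < r" for x r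
    unfolding S_def using that Dpos by (intro average_shifted_cube_diff v) (force simp: mem_cube)+
  have upper: "local_maximal l v x \<le> ennreal (c + K) + W x" if x: "x \<in> cube a s" for x
    unfolding local_maximal_def
  proof (rule SUP_least)
    fix k :: nat
    define r where "r = l / 2 ^ k"
    have r: "r \<in> D" by (auto simp: r_def D_def)
    have "ennreal (average (cube x r) v) \<le> ennreal (c + K) + W x"
    proof (cases "r \<le> s")
      case True
      have "ennreal (average (cube x r) v) \<le> ennreal ((c + K) + max 0 (average (cube x r) v - m - K))"
        using c_ge[of m] by (intro ennreal_leI) auto
      also have "\<dots> = ennreal (c + K) + ennreal (average (cube x r) v - m - K)"
        using c0 K by (subst ennreal_plus) (auto simp: max_def ennreal_neg)
      also have "\<dots> \<le> ennreal (c + K) + W x"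
        unfolding W_def using r True by (intro add_left_mono SUP_upper) auto
      finally show ?thesis .
    next
      case False
      then have "average (cube x r) v \<le> c + K"
        using big[OF x r] c_ge[of "average (cube a r) v"] r K by auto
      then have "ennreal (average (cube x r) v) \<le> ennreal (c + K)" by (rule ennreal_leI)
      then show ?thesis by (rule order_trans) simp
    qed
    then show "ennreal (average (cube x (l / 2 ^ k)) v) \<le> ennreal (c + K) + W x" by (simp add: r_def)
  qed
  have ptwise: "AE x in lebesgue. x \<in> cube a s \<longrightarrow> ennreal \<bar>h x - c\<bar> \<le> ennreal (K + \<bar>v x - m\<bar>) + W x"
    using AE_le_local_maximal[OF vl l]
  proof eventually_elim
    case (elim x)
    show ?case
    proof
      assume x: "x \<in> cube a s"
      show "ennreal \<bar>h x - c\<bar> \<le> ennreal (K + \<bar>v x - m\<bar>) + W x"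
      \<comment> \<open>Where \<open>W\<close> is infinite the bound is trivial. Elsewhere
        \<open>upper\<close> makes the maximal function finite, so that \<open>h\<close> really is
        its value.\<close>
      proof (cases "W x = \<infinity>")
        case False
        then obtain w where w: "W x = ennreal w" "w \<ge> 0"
          by (cases "W x") auto
        then have "local_maximal l v x \<le> ennreal (c + K + w)"
          using upper[OF x] c0 K by (simp add: ennreal_plus)
        moreover from this have "local_maximal l v x < top"
          using ennreal_less_top le_less_trans by blast
        ultimately have H: "local_maximal l v x = ennreal (h x)" and hu: "h x \<le> c + K + w"
          using c0 K w unfolding h_def by (simp_all add: enn2real_leI del: ennreal_plus)
        have h0: "h x \<ge> 0" by (simp add: h_def)
        have "v x \<le> h x" using elim h0 by (simp add: H)
        \<comment> \<open>If \<open>c = m\<close>, then \<open>m\<close> is within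
          \<open>\<bar>v x - m\<bar>\<close> of \<open>v x\<close>, which is at most
          \<open>h x\<close> by differentiation. Otherwise \<open>c\<close> is the average at some
          scale above \<open>s\<close>, and moving that cube to \<open>x\<close> costs at most
          \<open>K\<close>.\<close>
        moreover have "c \<le> h x + K + \<bar>v x - m\<bar>"
        proof (cases "c = m")
          case True
          then show ?thesis using \<open>v x \<le> h x\<close> K by simp
        next
          case False
          then obtain k where k: "c = average (cube a (l / 2 ^ k)) v" "s < l / 2 ^ k"
            using c_in by (auto simp: D_def)
          have "ennreal (average (cube x (l / 2 ^ k)) v) \<le> ennreal (h x)"
            unfolding H[symmetric] local_maximal_def by (rule SUP_upper) simp
          then have "average (cube x (l / 2 ^ k)) v \<le> h x" using h0 by simp
          moreover have "l / 2 ^ k \<in> D" by (auto simp: D_def)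
          ultimately show ?thesis using big[OF x, of "l / 2 ^ k"] k K by linarith
        qed
        ultimately have "\<bar>h x - c\<bar> \<le> (K + \<bar>v x - m\<bar>) + w" using hu w by linarith
        then have "ennreal \<bar>h x - c\<bar> \<le> ennreal ((K + \<bar>v x - m\<bar>) + w)" by (rule ennreal_leI)
        then show ?thesis using w K by (simp add: ennreal_plus)
      qed simp
    qed
  qed
  have W_int: "(\<integral>\<^sup>+x\<in>cube a s. W x \<partial>lebesgue) \<le> ennreal (s ^ DIM('a) * (2 * b))"
  proof -
    have "(\<integral>\<^sup>+x\<in>cube a s. W x \<partial>lebesgue) \<le> 2 * (\<integral>\<^sup>+x\<in>cube a s. ennreal \<bar>v x - m\<bar> \<partial>lebesgue)"
      unfolding W_def K_def S_def by (rule nn_integral_local_maximal[OF v _ Dpos s]) (auto simp: D_def)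
    also have "\<dots> = ennreal (s ^ DIM('a) * (2 * average (cube a s) (\<lambda>x. \<bar>v x - m\<bar>)))"
      unfolding mult.left_commute[of "s ^ DIM('a)" 2] two_mult_ennreal[symmetric]
      by (subst nn_integral_eq_average[OF s refl]) (auto intro!: locally_integrable_intros vl)
    also have "\<dots> \<le> ennreal (s ^ DIM('a) * (2 * b))"
      using osc_leD[OF v s, of a] s by (intro ennreal_leI mult_left_mono) (auto simp: m_def)
    finally show ?thesis .
  qed
  have "(\<integral>\<^sup>+x\<in>cube a s. ennreal \<bar>h x - c\<bar> \<partial>lebesgue)
      \<le> (\<integral>\<^sup>+x\<in>cube a s. ennreal (K + \<bar>v x - m\<bar>) + W x \<partial>lebesgue)"
    by (rule nn_integral_mono_AE) (use ptwise in eventually_elim, auto split: split_indicator)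
  also have "\<dots> = (\<integral>\<^sup>+x\<in>cube a s. ennreal (K + \<bar>v x - m\<bar>) \<partial>lebesgue) + (\<integral>\<^sup>+x\<in>cube a s. W x \<partial>lebesgue)"
    by (rule nn_set_integral_add) (use W_meas locally_integrable_measurable[OF vl] in \<open>auto\<close>)
  also have "(\<integral>\<^sup>+x\<in>cube a s. ennreal (K + \<bar>v x - m\<bar>) \<partial>lebesgue) =
      ennreal (s ^ DIM('a) * (K + average (cube a s) (\<lambda>x. \<bar>v x - m\<bar>)))"
    by (subst nn_integral_eq_average[OF s refl])
      (use K in \<open>auto intro!: locally_integrable_intros vl simp: average_add[OF s refl] average_const[OF s refl] locally_integrable_intros vl\<close>)
  also have "\<dots> + (\<integral>\<^sup>+x\<in>cube a s. W x \<partial>lebesgue)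
     \<le> ennreal (s ^ DIM('a) * (K + b)) + ennreal (s ^ DIM('a) * (2 * b))"
    using osc_leD[OF v s, of a] s by (intro add_mono W_int ennreal_leI mult_left_mono) (auto simp: m_def)
  \<comment> \<open>\<open>K\<close> contributes \<open>S + 2\<close>, the oscillation of
    \<open>v\<close> contributes 1 and \<open>W\<close> contributes 2.\<close>
  also have "\<dots> = ennreal (s ^ DIM('a) * ((S + 5) * b))"
  proof (subst ennreal_plus[symmetric])
    show "0 \<le> s ^ DIM('a) * (K + b)" using K b s by (intro mult_nonneg_nonneg) auto
    show "0 \<le> s ^ DIM('a) * (2 * b)" using b s by (intro mult_nonneg_nonneg) auto
  qed (simp add: K_def algebra_simps)
  finally have "(\<integral>\<^sup>+x\<in>cube a s. ennreal \<bar>h x - c\<bar> \<partial>lebesgue) \<le> ennreal (s ^ DIM('a) * ((S + 5) * b))" .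
  \<comment> \<open>No scale \<open>l / 2 ^ k\<close> exceeds \<open>l\<close>, so the set defining
    \<open>c\<close> reduces to \<open>m\<close>.\<close>
  moreover have "c = m" if "s = l"
  proof -
    have "l / 2 ^ k \<le> l" for k using l by (simp add: field_simps)
    then have "r \<le> s" if "r \<in> D" for r using that \<open>s = l\<close> unfolding D_def by blast
    then have "D \<inter> {s<..} = {}" by (force simp: not_less[symmetric])
    then show ?thesis using c_in by simp
  qed
  ultimately show "\<exists>c. (s = l \<longrightarrow> c = average (cube a s) v) \<and>
      (\<integral>\<^sup>+x\<in>cube a s. ennreal \<bar>h x - c\<bar> \<partial>lebesgue) \<le> ennreal (s ^ DIM('a) * ((shift_const TYPE('a) + 5) * b))"
    by (auto simp: m_def S_def)
  have "AE x in lebesgue. W x * indicator (cube a s) x \<noteq> \<infinity>"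
  proof (rule nn_integral_noteq_infinite)
    show "(\<integral>\<^sup>+x\<in>cube a s. W x \<partial>lebesgue) \<noteq> \<infinity>" using W_int by (auto simp: top_unique)
  qed (intro borel_measurable_times_ennreal W_meas borel_measurable_indicator, simp)
  then show "AE x in lebesgue. x \<in> cube a s \<longrightarrow> local_maximal l v x < \<infinity>"
  proof eventually_elim
    case (elim x)
    show ?case
    proof
      assume x: "x \<in> cube a s"
      then have "ennreal (c + K) + W x < \<infinity>" using elim by (simp add: less_top)
      with upper[OF x] show "local_maximal l v x < \<infinity>" by (rule le_less_trans)
    qed
  qed
qed

text \<open>The first claim takes the \<open>c\<close> of the previous lemma on each cube as
  reference value. The second uses that on cubes of side \<open>l\<close> this value is the average
  of \<open>v\<close>.\<close>

lemma osc_le_local_maximal: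
  fixes v :: "'a::euclidean_space \<Rightarrow> real"
  assumes v: "osc_le b v" and nonneg: "\<And>x. 0 \<le> v x" and l: "l > 0"
  defines "h \<equiv> \<lambda>x. enn2real (local_maximal l v x)"
  shows "osc_le (2 * ((shift_const TYPE('a) + 5) * b)) h"
    and "average (cube a l) h \<le> average (cube a l) v + (shift_const TYPE('a) + 5) * b"
proof -
  let ?B = "(shift_const TYPE('a) + 5) * b"
  have B: "?B \<ge> 0" using osc_le_nonneg[OF v] by (simp add: shift_const_def)
  have hm: "h \<in> borel_measurable lebesgue"
    unfolding h_def using local_maximal_measurable[OF osc_le_locally_integrable[OF v] l] by simp
  have ex: "\<exists>c. (s = l \<longrightarrow> c = average (cube a s) v) \<and>
      (\<integral>\<^sup>+x\<in>cube a s. ennreal \<bar>h x - c\<bar> \<partial>lebesgue) \<le> ennreal (s ^ DIM('a) * ?B)" if "s > 0" for s a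
    using local_maximal_oscillation(1)[OF v nonneg l that] unfolding h_def .
  have hl: "locally_integrable h"
  proof (rule locally_integrableI[OF hm])
    fix a :: 'a and s :: real assume s: "s > 0"
    obtain c where c: "(\<integral>\<^sup>+x\<in>cube a s. ennreal \<bar>h x - c\<bar> \<partial>lebesgue) \<le> ennreal (s ^ DIM('a) * ?B)"
      using ex[OF s] by blast
    have "(\<integral>\<^sup>+x\<in>cube a s. ennreal \<bar>h x\<bar> \<partial>lebesgue) \<le> (\<integral>\<^sup>+x\<in>cube a s. ennreal \<bar>h x - c\<bar> + ennreal \<bar>c\<bar> \<partial>lebesgue)"
      by (intro nn_integral_mono mult_right_mono) (auto simp: ennreal_plus[symmetric] simp del: ennreal_plus intro!: ennreal_leI)
    also have "\<dots> = (\<integral>\<^sup>+x\<in>cube a s. ennreal \<bar>h x - c\<bar> \<partial>lebesgue) + (\<integral>\<^sup>+x\<in>cube a s. ennreal \<bar>c\<bar> \<partial>lebesgue)"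
      by (rule nn_set_integral_add) (use hm in auto)
    also have "(\<integral>\<^sup>+x\<in>cube a s. ennreal \<bar>c\<bar> \<partial>lebesgue) = ennreal (\<bar>c\<bar> * s ^ DIM('a))"
      using s by (subst nn_integral_cmult_indicator) (simp_all add: emeasure_cube ennreal_mult' del: emeasure_completion)
    also have "(\<integral>\<^sup>+x\<in>cube a s. ennreal \<bar>h x - c\<bar> \<partial>lebesgue) + ennreal (\<bar>c\<bar> * s ^ DIM('a)) < \<infinity>"
      using c le_less_trans[OF c ennreal_less_top] by simp
    finally show "(\<integral>\<^sup>+x\<in>cube a s. ennreal \<bar>h x\<bar> \<partial>lebesgue) < \<infinity>" .
  qed
  have ex': "\<exists>c. (s = l \<longrightarrow> c = average (cube a s) v) \<and> average (cube a s) (\<lambda>x. \<bar>h x - c\<bar>) \<le> ?B" if s: "s > 0" for s a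
  proof -
    obtain c where c: "s = l \<longrightarrow> c = average (cube a s) v"
      "(\<integral>\<^sup>+x\<in>cube a s. ennreal \<bar>h x - c\<bar> \<partial>lebesgue) \<le> ennreal (s ^ DIM('a) * ?B)"
      using ex[OF s] by blast
    have "average (cube a s) (\<lambda>x. \<bar>h x - c\<bar>) \<le> ?B"
      by (rule average_le_if_nn_integral_le[OF s refl _ _ B c(2)]) (auto intro!: locally_integrable_intros hl)
    with c(1) show ?thesis by blast
  qed
  show "osc_le (2 * ?B) h"
    using ex' by (intro osc_leI hl) blast
  have "average (cube a l) (\<lambda>x. \<bar>h x - average (cube a l) v\<bar>) \<le> ?B"
    using ex'[OF l, of a] by blast
  then show "average (cube a l) h \<le> average (cube a l) v + ?B"
    using abs_average_diff_le[OF l refl hl, of a "average (cube a l) v"] by linarith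
qed

subsection \<open>The dyadic maximal function\<close>

text \<open>Organizes the dyadic cubes by generation: each generation has finitely many corners,
  hence there are countably many cubes.\<close>

primrec dyadic_corners :: "'a::euclidean_space \<Rightarrow> real \<Rightarrow> nat \<Rightarrow> 'a set" where
  "dyadic_corners a l 0 = {a}"
| "dyadic_corners a l (Suc k) = (\<Union>B\<in>Pow Basis. (\<lambda>u. u + (l / 2 ^ Suc k) *\<^sub>R \<Sum>B) ` dyadic_corners a l k)"

lemma finite_dyadic_corners: "finite (dyadic_corners a l k)"
  by (induction k) auto

lemma dyadic_cubes_corners:
  fixes a :: "'a::euclidean_space"
  assumes "l > 0" "P \<in> dyadic_cubes (cube a l)"
  shows "\<exists>k u. P = cube u (l / 2 ^ k) \<and> u \<in> dyadic_corners a l k \<and> P \<subseteq> cube a l"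
  using assms(2)
proof induction
  case top
  have "cube a l = cube a (l / 2 ^ 0)" "a \<in> dyadic_corners a l 0" by simp_all
  then show ?case by blast
next
  case (subdivide u r B)
  then obtain k w where w: "cube u r = cube w (l / 2 ^ k)" "w \<in> dyadic_corners a l k" "cube u r \<subseteq> cube a l"
    by blast
  have "u \<in> cube u r" using \<open>r > 0\<close> by (simp add: mem_cube)
  \<comment> \<open>The subdivision rule accepts any representation of the parent as a cube. A
    nonempty box determines its corners, so \<open>u\<close> and \<open>r\<close> agree with those
    of the induction hypothesis.\<close>
  with w(1) have uw: "u = w" "u + r *\<^sub>R One = w + (l / 2 ^ k) *\<^sub>R One"
    unfolding eq_cbox by blast+
  then have "r *\<^sub>R (One::'a) = (l / 2 ^ k) *\<^sub>R One" by simp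
  then have r: "r = l / 2 ^ k" unfolding scaleR_cancel_right by simp
  let ?u = "u + (r / 2) *\<^sub>R \<Sum>B"
  have "cube ?u (r / 2) \<subseteq> cube a l"
    using halving_subset[of r B u] subdivide.hyps w(3) by blast
  moreover have r2: "r / 2 = l / 2 ^ Suc k" by (simp add: r)
  moreover have "?u \<in> dyadic_corners a l (Suc k)"
    unfolding dyadic_corners.simps r2 using w(2) subdivide.hyps uw(1) by blast
  ultimately show ?case by metis
qed

lemma dyadic_cubesE:
  fixes a :: "'a::euclidean_space"
  assumes "l > 0" "P \<in> dyadic_cubes (cube a l)"
  obtains k u where "P = cube u (l / 2 ^ k)" "P \<subseteq> cube a l"
  using dyadic_cubes_corners[OF assms] by blast

lemma countable_dyadic_cubes:
  fixes a :: "'a::euclidean_space"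
  assumes l: "l > 0"
  shows "countable (dyadic_cubes (cube a l))"
proof -
  have "countable (\<Union>k. (\<lambda>u. cube u (l / 2 ^ k)) ` dyadic_corners a l k)"
    by (auto intro: countable_finite finite_dyadic_corners)
  moreover have "dyadic_cubes (cube a l) \<subseteq> (\<Union>k. (\<lambda>u. cube u (l / 2 ^ k)) ` dyadic_corners a l k)"
  proof
    fix P assume "P \<in> dyadic_cubes (cube a l)"
    then obtain k u where "P = cube u (l / 2 ^ k)" "u \<in> dyadic_corners a l k"
      using dyadic_cubes_corners[OF l] by metis
    then show "P \<in> (\<Union>k. (\<lambda>u. cube u (l / 2 ^ k)) ` dyadic_corners a l k)"
      by (intro UN_I[of k] image_eqI[of _ _ u]) auto
  qed
  ultimately show ?thesis by (rule countable_subset[rotated])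
qed

lemma dyadic_cubes_cover:
  fixes a :: "'a::euclidean_space"
  assumes "l > 0" "x \<in> cube a l"
  obtains u where "cube u (l / 2 ^ k) \<in> dyadic_cubes (cube a l)" "x \<in> cube u (l / 2 ^ k)"
proof -
  have "\<exists>u. cube u (l / 2 ^ k) \<in> dyadic_cubes (cube a l) \<and> x \<in> cube u (l / 2 ^ k)"
  proof (induction k)
    case 0
    then show ?case using assms by (auto intro!: exI[of _ a] dyadic_cubes.top)
  next
    case (Suc k)
    then obtain u where u: "cube u (l / 2 ^ k) \<in> dyadic_cubes (cube a l)" "x \<in> cube u (l / 2 ^ k)" by blast
    have pos: "l / 2 ^ k > 0" using assms by simp
    obtain B where B: "B \<subseteq> Basis" "x \<in> cube (u + (l / 2 ^ k / 2) *\<^sub>R \<Sum>B) (l / 2 ^ k / 2)"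
      using halving_cover[OF pos u(2)] .
    have "l / 2 ^ k / 2 = l / 2 ^ Suc k" by simp
    with dyadic_cubes.subdivide[OF u(1) pos B(1)] B(2) show ?case by metis
  qed
  then show ?thesis using that by blast
qed

lemma dyadic_maximal_measurable:
  fixes a :: "'a::euclidean_space"
  assumes "l > 0"
  shows "dyadic_maximal (cube a l) f \<in> borel_measurable lebesgue"
  unfolding dyadic_maximal_def[abs_def]
proof (intro borel_measurable_SUP countable_dyadic_cubes assms borel_measurable_times_ennreal borel_measurable_const borel_measurable_indicator)
  fix P assume "P \<in> dyadic_cubes (cube a l)"
  then obtain k u where "P = cube u (l / 2 ^ k)" using dyadic_cubesE[OF assms] by metis
  then show "P \<in> sets lebesgue" by simp
qed

lemma average_le_dyadic_maximal:
  "x \<in> Q \<Longrightarrow> ennreal (average Q (\<lambda>y. \<bar>f y\<bar>)) \<le> dyadic_maximal Q f x"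
  unfolding dyadic_maximal_def by (rule SUP_upper2[OF dyadic_cubes.top]) simp

text \<open>Each dyadic cube containing \<open>x\<close> is compared with the cube of the same side
  at \<open>x\<close>, which is where the additive error arises.\<close>

lemma dyadic_maximal_le_local_maximal:
  fixes f :: "'a::euclidean_space \<Rightarrow> real"
  assumes f: "osc_le b (\<lambda>x. \<bar>f x\<bar>)" and l: "l > 0"
  shows "dyadic_maximal (cube a l) f x \<le> local_maximal l (\<lambda>x. \<bar>f x\<bar>) x + ennreal (shift_const TYPE('a) * b)"
  unfolding dyadic_maximal_def
proof (rule SUP_least)
  fix P assume P: "P \<in> dyadic_cubes (cube a l)"
  obtain k u where u: "P = cube u (l / 2 ^ k)" using dyadic_cubesE[OF l P] .
  let ?r = "l / 2 ^ k" and ?v = "\<lambda>x. \<bar>f x\<bar>"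
  have r: "?r > 0" using l by simp
  have fl: "locally_integrable ?v" using f by (rule osc_le_locally_integrable)
  show "ennreal (average P ?v) * indicator P x \<le> local_maximal l ?v x + ennreal (shift_const TYPE('a) * b)"
  proof (cases "x \<in> P")
    case True
    then have "average P ?v \<le> average (cube x ?r) ?v + shift_const TYPE('a) * b"
      using average_shifted_cube_diff[OF f, of x u ?r ?r] r by (auto simp: u)
    then have "ennreal (average P ?v) \<le> ennreal (average (cube x ?r) ?v + shift_const TYPE('a) * b)"
      by (rule ennreal_leI)
    also have "\<dots> = ennreal (average (cube x ?r) ?v) + ennreal (shift_const TYPE('a) * b)"
      using osc_le_nonneg[OF f] by (intro ennreal_plus average_nonneg[OF r refl] fl) (auto simp: shift_const_def)
    also have "\<dots> \<le> local_maximal l ?v x + ennreal (shift_const TYPE('a) * b)"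
      unfolding local_maximal_def by (intro add_right_mono SUP_upper) simp
    finally show ?thesis using True by simp
  qed simp
qed

text \<open>Differentiation is available along cubes at \<open>x\<close>; each of them is exchanged
  for a dyadic cube of the same side containing \<open>x\<close>, which again costs an additive
  error.\<close>

lemma AE_le_dyadic_maximal:
  fixes f :: "'a::euclidean_space \<Rightarrow> real"
  assumes f: "osc_le b (\<lambda>x. \<bar>f x\<bar>)" and l: "l > 0"
  shows "AE x in lebesgue. x \<in> cube a l \<longrightarrow>
    ennreal \<bar>f x\<bar> \<le> dyadic_maximal (cube a l) f x + ennreal (shift_const TYPE('a) * b)"
proof -
  let ?v = "\<lambda>x. \<bar>f x\<bar>"
  have fl: "locally_integrable ?v" using f by (rule osc_le_locally_integrable)
  have b: "shift_const TYPE('a) * b \<ge> 0" using osc_le_nonneg[OF f] by (simp add: shift_const_def)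
  show ?thesis using AE_average_tendsto[OF fl l]
  proof eventually_elim
    case (elim x)
    show ?case
    proof
      assume x: "x \<in> cube a l"
      have "ennreal (average (cube x (l / 2 ^ k)) ?v)
          \<le> dyadic_maximal (cube a l) f x + ennreal (shift_const TYPE('a) * b)" for k
      proof -
        let ?r = "l / 2 ^ k"
        have r: "?r > 0" using l by simp
        obtain u where u: "cube u ?r \<in> dyadic_cubes (cube a l)" "x \<in> cube u ?r"
          using dyadic_cubes_cover[OF l x] .
        have "average (cube x ?r) ?v \<le> average (cube u ?r) ?v + shift_const TYPE('a) * b"
          using average_shifted_cube_diff[OF f u(2) r, of ?r] r by auto
        then have "ennreal (average (cube x ?r) ?v) \<le> ennreal (average (cube u ?r) ?v + shift_const TYPE('a) * b)"
          by (rule ennreal_leI)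
        also have "\<dots> = ennreal (average (cube u ?r) ?v) * indicator (cube u ?r) x + ennreal (shift_const TYPE('a) * b)"
          using u(2) b by (simp add: ennreal_plus average_nonneg[OF r refl] fl)
        also have "\<dots> \<le> dyadic_maximal (cube a l) f x + ennreal (shift_const TYPE('a) * b)"
          unfolding dyadic_maximal_def by (intro add_right_mono SUP_upper u)
        finally show ?thesis .
      qed
      then show "ennreal \<bar>f x\<bar> \<le> dyadic_maximal (cube a l) f x + ennreal (shift_const TYPE('a) * b)"
        by (intro LIMSEQ_le_const2[OF tendsto_ennrealI[OF elim]]) auto
    qed
  qed
qed

subsection \<open>Domination\<close>

lemma measure_half_cube:
  fixes a :: "'a::euclidean_space"
  assumes l: "l > 0" and i: "i \<in> Basis"
  shows "measure lebesgue (cbox a (a + l *\<^sub>R One - (l / 2) *\<^sub>R i)) = l ^ DIM('a) / 2"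
proof -
  let ?b = "a + l *\<^sub>R One - (l / 2) *\<^sub>R i"
  have side: "?b \<bullet> j - a \<bullet> j = (if j = i then l / 2 else l)" if "j \<in> Basis" for j
    using i that by (simp add: inner_diff_left inner_add_left inner_Basis)
  then have "a \<bullet> j \<le> ?b \<bullet> j" if "j \<in> Basis" for j
    using side[OF that] l by (smt (verit) half_gt_zero)
  then have "cbox a ?b \<noteq> {}" by (simp only: box_ne_empty) blast
  then have "measure lebesgue (cbox a ?b) = (\<Prod>j\<in>Basis. ?b \<bullet> j - a \<bullet> j)"
    by (subst measure_completion) (auto intro!: content_cbox')
  also have "\<dots> = (\<Prod>j\<in>Basis. if j = i then l / 2 else l)"
    by (rule prod.cong[OF refl side])
  also have "\<dots> = l / 2 * l ^ (DIM('a) - 1)"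
    using i by (subst prod.remove[of _ i]) auto
  also have "\<dots> = l ^ DIM('a) / 2"
    using DIM_positive[where 'a='a] by (metis (no_types, lifting) times_divide_eq_left power_eq_if less_numeral_extra(3))
  finally show ?thesis .
qed

text \<open>The sign is 1 on the lower half of the cube in one coordinate direction and -1
  elsewhere.\<close>

lemma balanced_sign_exists:
  fixes a :: "'a::euclidean_space"
  assumes l: "l > 0"
  obtains \<sigma> :: "'a \<Rightarrow> real"
  where "\<sigma> \<in> borel_measurable lebesgue" "\<And>x. \<sigma> x = 1 \<or> \<sigma> x = -1" "average (cube a l) \<sigma> = 0"
proof -
  obtain i :: 'a where i: "i \<in> Basis" using nonempty_Basis by blast
  let ?W = "cbox a (a + l *\<^sub>R One - (l / 2) *\<^sub>R i)"
  let ?\<sigma> = "\<lambda>x. 2 * indicat_real ?W x - 1"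
  have sub: "?W \<subseteq> cube a l"
    using l i by (auto simp: mem_box inner_diff_left inner_Basis split: if_splits) (smt (verit) half_gt_zero)
  have W: "locally_integrable (indicat_real ?W)"
    by (rule locally_integrable_bounded[of _ 1]) (auto split: split_indicator intro!: borel_measurable_indicator)
  have "average (cube a l) (indicat_real ?W) = measure lebesgue ?W / l ^ DIM('a)"
    using l sub by (simp add: average_def measure_cube set_lebesgue_integral_def indicator_inter_arith[symmetric] Int_absorb1
        del: measure_completion)
  also have "\<dots> = 1 / 2" using measure_half_cube[OF l i] l by simp
  finally have "average (cube a l) ?\<sigma> = 0"
    by (subst average_diff[OF l refl])
      (auto intro!: locally_integrable_intros W simp: average_cmult[OF l refl] average_const[OF l refl])
  moreover have "?\<sigma> \<in> borel_measurable lebesgue"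
    by (intro borel_measurable_diff borel_measurable_times borel_measurable_const borel_measurable_indicator) simp
  ultimately show ?thesis by (intro that[of ?\<sigma>]) (auto split: split_indicator)
qed

text \<open>
  The quasi-triangle constants of the spaces over different cubes need not be uniformly bounded, so
  the average of \<open>h\<close> cannot be split off inside the quasi-norm. Instead \<open>2 * h\<close> is altered by
  a bounded amount where it is small, with balanced signs, so that it stays away from its average.
\<close>
lemma average_avoiding_modification:
  fixes h :: "'a::euclidean_space \<Rightarrow> real"
  assumes h: "osc_le b h" and nonneg: "\<And>x. 0 \<le> h x" and l: "l > 0" and A: "average (cube a l) h \<le> A"
  obtains g where "osc_le (4 * b + 56 * A) g" "\<And>x. h x \<le> 2 * \<bar>g x - average (cube a l) g\<bar>"
proof -
  obtain \<sigma> :: "'a \<Rightarrow> real" where \<sigma>: "\<sigma> \<in> borel_measurable lebesgue" "\<And>x. \<sigma> x = 1 \<or> \<sigma> x = -1"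
      "average (cube a l) \<sigma> = 0"
    using balanced_sign_exists[OF l, of a] by blast
  have hl: "locally_integrable h" using h by (rule osc_le_locally_integrable)
  have A0: "0 \<le> A" using average_nonneg[OF l refl hl, of a] nonneg A by simp
  have \<sigma>_bound: "\<bar>\<sigma> x\<bar> \<le> 1" for x using \<sigma>(2)[of x] by auto
  have \<sigma>l: "locally_integrable \<sigma>" using \<sigma>(1) \<sigma>_bound by (rule locally_integrable_bounded)
  \<comment> \<open>The average \<open>m\<close> of \<open>g\<close> will lie between
    \<open>- (6 * A)\<close> and \<open>8 * A\<close>. Where \<open>h > 8 * A\<close>,
    \<open>g - m\<close> is at least \<open>2 * h - 8 * A\<close>, hence larger than
    \<open>h\<close>. Where \<open>h \<le> 8 * A\<close>, the values \<open>12 * A\<close> and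
    \<open>- 12 * A\<close> stay at distance at least \<open>4 * A\<close> from \<open>m\<close>.
    The change from \<open>2 * h\<close> is at most \<open>12 * A + 16 * A = 28 * A\<close>.\<close>
  define g where "g x = (if h x > 8 * A then 2 * h x else 12 * A * \<sigma> x)" for x
  have [measurable]: "h \<in> borel_measurable lebesgue" "\<sigma> \<in> borel_measurable lebesgue"
    using hl \<sigma> by (auto intro: locally_integrable_measurable)
  have gm: "g \<in> borel_measurable lebesgue" unfolding g_def[abs_def] by measurable
  have "\<bar>g x - 2 * h x\<bar> \<le> 28 * A" for x
    using \<sigma>(2)[of x] nonneg[of x] A0 by (auto simp: g_def)
  from osc_le_perturb[OF osc_le_scale[OF h, of 2] gm this]
  have g: "osc_le (4 * b + 56 * A) g" by simp
  then have gl: "locally_integrable g" by (rule osc_le_locally_integrable)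
  define m where "m = average (cube a l) g"
  have "m \<le> average (cube a l) (\<lambda>x. 2 * h x + (6 * A + 6 * A * \<sigma> x))"
    unfolding m_def
  proof (rule average_mono[OF l refl gl])
    \<comment> \<open>The added term is \<open>12 * A\<close> where the sign is 1 and 0 where it is
      -1; its average is \<open>6 * A\<close> since the sign is balanced.\<close>
    show "g x \<le> 2 * h x + (6 * A + 6 * A * \<sigma> x)" for x
      using \<sigma>(2)[of x] nonneg[of x] A0 by (auto simp: g_def)
  qed (intro locally_integrable_intros hl \<sigma>l)
  also have "\<dots> = 2 * average (cube a l) h + (6 * A + 6 * A * 0)"
    unfolding \<sigma>(3)[symmetric]
    by (simp add: average_add[OF l refl] average_cmult[OF l refl] average_const[OF l refl] locally_integrable_intros hl \<sigma>l)
  finally have m_le: "m \<le> 8 * A" using A by simp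
  have "average (cube a l) (\<lambda>x. 6 * A * \<sigma> x - 6 * A) \<le> m"
    unfolding m_def
  proof (rule average_mono[OF l refl _ gl])
    show "6 * A * \<sigma> x - 6 * A \<le> g x" for x
      using \<sigma>(2)[of x] nonneg[of x] A0 by (auto simp: g_def)
  qed (intro locally_integrable_intros \<sigma>l)
  then have m_ge: "- (6 * A) \<le> m"
    by (simp add: average_diff[OF l refl] average_cmult[OF l refl] average_const[OF l refl] locally_integrable_intros \<sigma>l \<sigma>(3))
  have "h x \<le> 2 * \<bar>g x - m\<bar>" for x
    using \<sigma>(2)[of x] nonneg[of x] m_le m_ge A0 by (auto simp: g_def)
  with g show ?thesis using that by (simp add: m_def)
qed

text \<open>The function \<open>h + S * (2 * b)\<close> already dominates the maximal function and
  has average at most \<open>(4 * S + 11) * b\<close> on \<open>Q\<close>. It is then replaced by a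
  function whose distance from its own average dominates it, as is needed to apply a bound on
  \<open>BMO_X_norm\<close>.\<close>

lemma dyadic_maximal_dominated:
  fixes f :: "'a::euclidean_space \<Rightarrow> real" and a :: 'a
  assumes f: "osc_le b f" and l: "l > 0"
  defines "Q \<equiv> cube a l"
  obtains g where "osc_le ((272 * shift_const TYPE('a) + 776) * b) g"
    "AE x in lebesgue. x \<in> Q \<longrightarrow>
       dyadic_maximal Q (\<lambda>x. f x - average Q f) x \<le> ennreal (2 * \<bar>g x - average Q g\<bar>)"
proof -
  define S where "S = shift_const TYPE('a)"
  have S: "S \<ge> 0" by (simp add: S_def shift_const_def)
  have b: "b \<ge> 0" using f by (rule osc_le_nonneg)
  define v where "v x = \<bar>f x - average Q f\<bar>" for x
  define h where "h x = enn2real (local_maximal l v x)" for x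
  have v: "osc_le (2 * b) v" unfolding v_def[abs_def] using f by (rule osc_le_abs_diff)
  have h: "osc_le (2 * ((S + 5) * (2 * b))) h" and "average Q h \<le> average Q v + (S + 5) * (2 * b)"
    using osc_le_local_maximal[OF v _ l] unfolding h_def[abs_def] S_def Q_def by (simp_all add: v_def)
  moreover have "average Q v \<le> b" unfolding v_def[abs_def] Q_def using f l by (rule osc_leD)
  ultimately have "average Q h + S * (2 * b) \<le> (4 * S + 11) * b"
    by (simp add: algebra_simps)
  then have avg: "average Q (\<lambda>x. h x + S * (2 * b)) \<le> (4 * S + 11) * b"
    unfolding Q_def
    by (subst average_add[OF l refl])
      (auto intro!: locally_integrable_intros osc_le_locally_integrable[OF h] simp: average_const[OF l refl])
  have "osc_le (2 * (2 * ((S + 5) * (2 * b)) + S * (2 * b))) (\<lambda>x. h x + S * (2 * b))"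
    using S b by (intro osc_le_perturb[OF h]) (auto intro!: locally_integrable_measurable locally_integrable_intros osc_le_locally_integrable[OF h])
  moreover have "0 \<le> h x + S * (2 * b)" for x using S b by (simp add: h_def)
  ultimately obtain g where
    g: "osc_le (4 * (2 * (2 * ((S + 5) * (2 * b)) + S * (2 * b))) + 56 * ((4 * S + 11) * b)) g"
      "\<And>x. h x + S * (2 * b) \<le> 2 * \<bar>g x - average Q g\<bar>"
    using average_avoiding_modification[OF _ _ l avg[unfolded Q_def]] unfolding Q_def by metis
  have "4 * (2 * (2 * ((S + 5) * (2 * b)) + S * (2 * b))) + 56 * ((4 * S + 11) * b) = (272 * S + 776) * b"
    by (simp add: algebra_simps)
  with g(1) have "osc_le ((272 * shift_const TYPE('a) + 776) * b) g" by (simp only: S_def)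
  moreover have "AE x in lebesgue. x \<in> Q \<longrightarrow>
       dyadic_maximal Q (\<lambda>x. f x - average Q f) x \<le> ennreal (2 * \<bar>g x - average Q g\<bar>)"
    using local_maximal_oscillation(2)[OF v _ l l, of a]
  proof (rule eventually_mono)
    fix x assume fin: "x \<in> cube a l \<longrightarrow> local_maximal l v x < \<infinity>"
    show "x \<in> Q \<longrightarrow> dyadic_maximal Q (\<lambda>x. f x - average Q f) x \<le> ennreal (2 * \<bar>g x - average Q g\<bar>)"
    proof
      assume "x \<in> Q"
      \<comment> \<open>Finiteness matters here: \<open>enn2real\<close> sends infinity to 0, so
        \<open>h\<close> would otherwise not bound the maximal function.\<close>
      then have "local_maximal l v x = ennreal (h x)" using fin by (simp add: h_def Q_def)
      moreover have "dyadic_maximal Q (\<lambda>x. f x - average Q f) x \<le> local_maximal l v x + ennreal (S * (2 * b))"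
        using dyadic_maximal_le_local_maximal[OF v[unfolded v_def[abs_def]] l, of a x]
        by (simp only: Q_def S_def v_def[abs_def])
      ultimately have "dyadic_maximal Q (\<lambda>x. f x - average Q f) x \<le> ennreal (h x + S * (2 * b))"
        using S b by (simp add: ennreal_plus h_def)
      also have "\<dots> \<le> ennreal (2 * \<bar>g x - average Q g\<bar>)" using g(2) by (rule ennreal_leI)
      finally show "dyadic_maximal Q (\<lambda>x. f x - average Q f) x \<le> ennreal (2 * \<bar>g x - average Q g\<bar>)" .
    qed
  qed (simp add: v_def)
  ultimately show ?thesis by (rule that)
qed

text \<open>
  Adding \<open>2 * b\<close> times a balanced sign to \<open>f\<close> makes the maximal function at least \<open>b\<close> on the whole
  cube, which absorbs the additive error in the preceding pointwise bound.
\<close>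
lemma oscillation_dominated_by_dyadic_maximal:
  fixes f :: "'a::euclidean_space \<Rightarrow> real" and a :: 'a
  assumes f: "osc_le b f" and l: "l > 0"
  defines "Q \<equiv> cube a l"
  obtains g where "osc_le (6 * b) g"
    "AE x in lebesgue. x \<in> Q \<longrightarrow> ennreal \<bar>f x - average Q f\<bar>
       \<le> ennreal (12 * shift_const TYPE('a) + 3) * dyadic_maximal Q (\<lambda>x. g x - average Q g) x"
proof -
  define S where "S = shift_const TYPE('a)"
  have S: "S \<ge> 0" by (simp add: S_def shift_const_def)
  have b: "b \<ge> 0" using f by (rule osc_le_nonneg)
  have fl: "locally_integrable f" using f by (rule osc_le_locally_integrable)
  obtain \<sigma> :: "'a \<Rightarrow> real" where \<sigma>: "\<sigma> \<in> borel_measurable lebesgue" "\<And>x. \<sigma> x = 1 \<or> \<sigma> x = -1"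
      "average (cube a l) \<sigma> = 0"
    using balanced_sign_exists[OF l, of a] by blast
  have \<sigma>_bound: "\<bar>\<sigma> x\<bar> \<le> 1" for x using \<sigma>(2)[of x] by auto
  have \<sigma>l: "locally_integrable \<sigma>" using \<sigma>(1) \<sigma>_bound by (rule locally_integrable_bounded)
  define g where "g x = f x + 2 * b * \<sigma> x" for x
  have gl: "locally_integrable g" unfolding g_def[abs_def] by (intro locally_integrable_intros fl \<sigma>l)
  have "\<bar>g x - f x\<bar> \<le> 2 * b" for x using \<sigma>(2)[of x] b by (auto simp: g_def)
  from osc_le_perturb[OF f locally_integrable_measurable[OF gl] this]
  have g: "osc_le (6 * b) g" by simp
  have avg: "average Q g = average Q f"
    unfolding g_def[abs_def] Q_def
    by (simp add: average_add[OF l refl] average_cmult[OF l refl] locally_integrable_intros fl \<sigma>l \<sigma>(3))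
  define M where "M = dyadic_maximal Q (\<lambda>x. g x - average Q g)"
  \<comment> \<open>The added term has absolute value \<open>2 * b\<close> everywhere and leaves the
    average unchanged, while the oscillation of \<open>f\<close> averages to at most
    \<open>b\<close>; what remains is at least \<open>b\<close>.\<close>
  have "average Q (\<lambda>x. 2 * b - \<bar>f x - average Q f\<bar>) \<le> average Q (\<lambda>x. \<bar>g x - average Q g\<bar>)"
    unfolding avg unfolding Q_def
  proof (rule average_mono[OF l refl])
    show "2 * b - \<bar>f x - average (cube a l) f\<bar> \<le> \<bar>g x - average (cube a l) f\<bar>" for x
      using \<sigma>(2)[of x] b by (auto simp: g_def)
  qed (intro locally_integrable_intros fl gl)+
  moreover have "average Q (\<lambda>x. 2 * b - \<bar>f x - average Q f\<bar>) = 2 * b - average Q (\<lambda>x. \<bar>f x - average Q f\<bar>)"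
    unfolding Q_def
    by (subst average_diff[OF l refl]) (auto intro!: locally_integrable_intros fl simp: average_const[OF l refl])
  ultimately have b_le: "b \<le> average Q (\<lambda>x. \<bar>g x - average Q g\<bar>)"
    using osc_leD[OF f l, of a] by (simp only: Q_def)
  have M_ge: "ennreal b \<le> M x" if "x \<in> Q" for x
    unfolding M_def by (rule order_trans[OF ennreal_leI[OF b_le] average_le_dyadic_maximal[OF that]])
  \<comment> \<open>The oscillation bound \<open>6 * b\<close> for \<open>g\<close> doubles on
    passing to absolute values, whence the 12 in the final constant.\<close>
  have "AE x in lebesgue. x \<in> Q \<longrightarrow> ennreal \<bar>g x - average Q g\<bar> \<le> M x + ennreal (S * (2 * (6 * b)))"
    unfolding M_def S_def Q_def by (intro AE_le_dyadic_maximal osc_le_abs_diff g l)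
  then have "AE x in lebesgue. x \<in> Q \<longrightarrow> ennreal \<bar>f x - average Q f\<bar> \<le> ennreal (12 * S + 3) * M x"
  proof eventually_elim
    case (elim x)
    show ?case
    proof
      assume x: "x \<in> Q"
      have "\<bar>f x - average Q f\<bar> \<le> \<bar>g x - average Q g\<bar> + 2 * b"
        using \<sigma>(2)[of x] b unfolding avg by (auto simp: g_def)
      then have "ennreal \<bar>f x - average Q f\<bar> \<le> ennreal (\<bar>g x - average Q g\<bar> + 2 * b)" by (rule ennreal_leI)
      also have "\<dots> = ennreal \<bar>g x - average Q g\<bar> + ennreal (2 * b)" using b by simp
      also have "\<dots> \<le> (M x + ennreal (S * (2 * (6 * b)))) + ennreal (2 * b)"
        using elim x by (intro add_right_mono) simp
      also have "\<dots> = M x + ennreal (12 * S + 2) * ennreal b"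
        using S b by (simp add: add.assoc ennreal_plus[symmetric] ennreal_mult[symmetric] algebra_simps del: ennreal_plus)
      also have "\<dots> \<le> M x + ennreal (12 * S + 2) * M x"
        by (intro add_left_mono mult_left_mono M_ge x) simp
      also have "\<dots> = (ennreal 1 + ennreal (12 * S + 2)) * M x"
        by (simp add: distrib_right)
      also have "ennreal 1 + ennreal (12 * S + 2) = ennreal (12 * S + 3)"
        using S by (subst ennreal_plus[symmetric]) auto
      finally show "ennreal \<bar>f x - average Q f\<bar> \<le> ennreal (12 * S + 3) * M x" .
    qed
  qed
  with g show ?thesis using that by (simp add: M_def S_def)
qed

subsection \<open>Function spaces\<close>

lemma is_cubeE:
  assumes "is_cube Q"
  obtains a l where "l > 0" "Q = cube a l"
  using assms unfolding is_cube_def by blast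

lemma BMO_norm_le_iff:
  assumes "locally_integrable f" "b \<ge> 0"
  shows "BMO_norm f \<le> ennreal b \<longleftrightarrow> osc_le b f"
  using assms unfolding BMO_norm_def osc_le_def is_cube_def by (auto simp: SUP_le_iff)

lemma BMO_E:
  assumes "f \<in> BMO"
  obtains b where "b \<ge> 0" "BMO_norm f = ennreal b" "osc_le b f"
proof (cases "BMO_norm f")
  case (real b)
  then show ?thesis using that assms BMO_norm_le_iff[of f b] by (simp add: BMO_def)
qed (use assms in \<open>simp add: BMO_def\<close>)

lemma osc_le_imp_BMO:
  assumes "osc_le b f" shows "f \<in> BMO" "BMO_norm f \<le> ennreal b"
proof -
  show le: "BMO_norm f \<le> ennreal b"
    using assms BMO_norm_le_iff osc_le_locally_integrable osc_le_nonneg by blast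
  then show "f \<in> BMO"
    using assms osc_le_locally_integrable by (auto simp: BMO_def intro: le_less_trans)
qed

lemma AE_lebesgue_on_cube_iff:
  fixes a :: "'a::euclidean_space"
  assumes "Q = cube a l"
  shows "(AE x in lebesgue_on Q. P x) \<longleftrightarrow> (AE x in lebesgue. x \<in> Q \<longrightarrow> P x)"
  by (subst AE_restrict_space_iff) (simp_all add: assms)

context quasi_banach_function_space
begin

text \<open>The factor \<open>k\<close> passes to the quasi-norm unchanged through scaling and
  monotonicity, so estimates obtained this way are uniform in \<open>Q\<close>.\<close>

lemma dominated_mem_qnorm_le:
  assumes "g \<in> X" "f \<in> borel_measurable (lebesgue_on Q)" "k \<ge> 0"
    "AE x in lebesgue_on Q. \<bar>f x\<bar> \<le> k * \<bar>g x\<bar>"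
  shows "f \<in> X" "N f \<le> k * N g"
proof -
  have g: "(\<lambda>x. k * g x) \<in> X" using assms(1) by (rule scale_mem)
  have le: "AE x in lebesgue_on Q. \<bar>f x\<bar> \<le> \<bar>k * g x\<bar>"
    using assms(3,4) by (simp add: abs_mult)
  show f: "f \<in> X" using g assms(2) le by (rule ideal)
  show "N f \<le> k * N g" using compatible[OF f g le] assms(3) scale[OF assms(1), of k] by simp
qed

end

section \<open>From pointwise domination to norm inequalities\<close>

lemma extended_qnorm_ennreal_le:
  assumes "extended_qnorm_ennreal Q X N g \<le> ennreal B" "B \<ge> 0"
  shows "AE x in lebesgue_on Q. g x < \<infinity>" "(\<lambda>x. enn2real (g x)) \<in> X" "N (\<lambda>x. enn2real (g x)) \<le> B"
  using assms by (auto simp: extended_qnorm_ennreal_def extended_qnorm_def top_unique split: if_splits)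

lemma extended_qnorm_leD:
  assumes "extended_qnorm X N g \<le> ennreal B" "B \<ge> 0"
  shows "g \<in> X" "N g \<le> B"
  using assms by (auto simp: extended_qnorm_def top_unique split: if_splits)

text \<open>\<open>Q\<close> is one of its own dyadic cubes, so the maximal function dominates the
  mean oscillation times the indicator of \<open>Q\<close>, whose quasi-norm is at least
  \<open>c\<close>.\<close>

lemma average_oscillation_le_BMO_MX_norm:
  fixes f :: "'a::euclidean_space \<Rightarrow> real"
  assumes X: "quasi_banach_function_space Q X N" and l: "l > 0" and Q: "Q = cube a l"
    and ind: "indicator Q \<in> X" "c \<le> N (indicator Q)" "c > 0" and f: "locally_integrable f"
  shows "ennreal c * ennreal (average Q (\<lambda>x. \<bar>f x - average Q f\<bar>))
    \<le> extended_qnorm_ennreal Q X N (dyadic_maximal Q (\<lambda>x. f x - average Q f))"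
proof -
  interpret quasi_banach_function_space Q X N by (rule X)
  let ?M = "dyadic_maximal Q (\<lambda>x. f x - average Q f)"
  let ?A = "average Q (\<lambda>x. \<bar>f x - average Q f\<bar>)"
  have A: "?A \<ge> 0" unfolding Q by (rule average_nonneg[OF l refl]) (auto intro!: locally_integrable_intros f)
  show ?thesis
  proof (cases "extended_qnorm_ennreal Q X N ?M")
    case (real B)
    then have fin: "AE x in lebesgue_on Q. ?M x < \<infinity>" and mem: "(\<lambda>x. enn2real (?M x)) \<in> X"
      and le: "N (\<lambda>x. enn2real (?M x)) \<le> B"
      using extended_qnorm_ennreal_le[of Q X N ?M B] by simp_all
    have mem2: "(\<lambda>x. ?A * indicator Q x) \<in> X" using ind(1) by (rule scale_mem)
    have "AE x in lebesgue_on Q. \<bar>?A * indicator Q x\<bar> \<le> \<bar>enn2real (?M x)\<bar>"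
      unfolding AE_lebesgue_on_cube_iff[OF Q]
      using fin[unfolded AE_lebesgue_on_cube_iff[OF Q]]
    proof eventually_elim
      case (elim x)
      show ?case
      proof
        assume x: "x \<in> Q"
        have "ennreal ?A \<le> ?M x" using x by (rule average_le_dyadic_maximal)
        then have "enn2real (ennreal ?A) \<le> enn2real (?M x)" using elim x by (intro enn2real_mono) auto
        then show "\<bar>?A * indicator Q x\<bar> \<le> \<bar>enn2real (?M x)\<bar>" using x A by simp
      qed
    qed
    from compatible[OF mem2 mem this] have "?A * N (indicator Q) \<le> B"
      using le scale[OF ind(1), of ?A] A by simp
    then have "c * ?A \<le> B" using mult_right_mono[OF ind(2) A] by (simp add: mult.commute)
    then show ?thesis using real ind(3) by (simp add: ennreal_mult'[symmetric] ennreal_leI)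
  qed simp
qed

lemma dyadic_maximal_measurable_on:
  "l > 0 \<Longrightarrow> Q = cube a l \<Longrightarrow> (\<lambda>x. enn2real (dyadic_maximal Q f x)) \<in> borel_measurable (lebesgue_on Q)"
  using dyadic_maximal_measurable[of l a f] by (intro measurable_restrict_space1) simp

text \<open>The hypothesis is applied to a dominating function chosen anew for each
  \<open>Q\<close>; its \<open>BMO\<close> norm is bounded by the same multiple of that of
  \<open>f\<close> every time, so the supremum over \<open>Q\<close> keeps the constant.\<close>

lemma BMO_MX_norm_bound:
  fixes f :: "'a::euclidean_space \<Rightarrow> real"
  assumes X: "\<And>Q. is_cube Q \<Longrightarrow> quasi_banach_function_space Q (X Q) (N Q)"
    and C: "\<And>f. f \<in> BMO \<Longrightarrow> BMO_X_norm X N f \<le> ennreal C * BMO_norm f" "C > 0"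
    and f: "f \<in> BMO"
  shows "BMO_MX_norm X N f \<le> ennreal (2 * C * (272 * shift_const TYPE('a) + 776)) * BMO_norm f"
  unfolding BMO_MX_norm_def
proof (rule SUP_least)
  fix Q :: "'a set" assume "Q \<in> {Q. is_cube Q}"
  then have Q: "is_cube Q" by simp
  then obtain a l where l: "l > 0" and Ql: "Q = cube a l" by (rule is_cubeE)
  interpret quasi_banach_function_space Q "X Q" "N Q" using X[OF Q] .
  obtain b where b: "b \<ge> 0" "BMO_norm f = ennreal b" "osc_le b f" using BMO_E[OF f] .
  let ?K = "272 * shift_const TYPE('a) + 776"
  let ?M = "dyadic_maximal Q (\<lambda>x. f x - average Q f)"
  have K: "?K \<ge> 0" by (simp add: shift_const_def)
  obtain g where g: "osc_le (?K * b) g"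
    and dom: "AE x in lebesgue. x \<in> Q \<longrightarrow> ?M x \<le> ennreal (2 * \<bar>g x - average Q g\<bar>)"
    using dyadic_maximal_dominated[OF b(3) l, of a] unfolding Ql by blast
  have "extended_qnorm (X Q) (N Q) (\<lambda>x. g x - average Q g) \<le> BMO_X_norm X N g"
    unfolding BMO_X_norm_def using Q by (intro SUP_upper) simp
  also have "\<dots> \<le> ennreal C * BMO_norm g" using osc_le_imp_BMO(1)[OF g] by (rule C)
  also have "\<dots> \<le> ennreal C * ennreal (?K * b)"
    by (intro mult_left_mono osc_le_imp_BMO(2)[OF g]) simp
  also have "\<dots> = ennreal (C * (?K * b))" using C(2) by (simp add: ennreal_mult')
  finally have "(\<lambda>x. g x - average Q g) \<in> X Q" "N Q (\<lambda>x. g x - average Q g) \<le> C * (?K * b)"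
    using extended_qnorm_leD C(2) K b(1) by (metis mult_nonneg_nonneg less_imp_le)+
  note gX = this
  have fin: "AE x in lebesgue_on Q. ?M x < \<infinity>"
    unfolding AE_lebesgue_on_cube_iff[OF Ql]
    using dom by eventually_elim (auto intro: le_less_trans)
  have le: "AE x in lebesgue_on Q. \<bar>enn2real (?M x)\<bar> \<le> 2 * \<bar>g x - average Q g\<bar>"
    unfolding AE_lebesgue_on_cube_iff[OF Ql]
    using dom by eventually_elim (auto intro: enn2real_leI)
  have "(\<lambda>x. enn2real (?M x)) \<in> X Q" "N Q (\<lambda>x. enn2real (?M x)) \<le> 2 * N Q (\<lambda>x. g x - average Q g)"
    using dominated_mem_qnorm_le[OF gX(1) dyadic_maximal_measurable_on[OF l Ql] _ le] by simp_all
  then have "extended_qnorm_ennreal Q (X Q) (N Q) ?M \<le> ennreal (2 * (C * (?K * b)))"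
    using fin gX(2) by (auto simp: extended_qnorm_ennreal_def extended_qnorm_def intro!: ennreal_leI)
  also have "2 * (C * (?K * b)) = (2 * C * ?K) * b" by (simp only: mult.assoc)
  also have "ennreal \<dots> = ennreal (2 * C * ?K) * BMO_norm f"
    unfolding b(2) using C(2) K by (intro ennreal_mult') (auto intro!: mult_nonneg_nonneg)
  finally show "extended_qnorm_ennreal Q (X Q) (N Q) ?M \<le> ennreal (2 * C * ?K) * BMO_norm f" .
qed

text \<open>The same scheme with the two expressions exchanged; 6 comes from the \<open>BMO\<close>
  bound on \<open>g\<close> and the remaining factor from the pointwise domination.\<close>

lemma BMO_X_norm_bound:
  fixes f :: "'a::euclidean_space \<Rightarrow> real"
  assumes X: "\<And>Q. is_cube Q \<Longrightarrow> quasi_banach_function_space Q (X Q) (N Q)"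
    and C: "\<And>f. f \<in> BMO \<Longrightarrow> BMO_MX_norm X N f \<le> ennreal C * BMO_norm f" "C > 0"
    and f: "f \<in> BMO"
  shows "BMO_X_norm X N f \<le> ennreal (6 * C * (12 * shift_const TYPE('a) + 3)) * BMO_norm f"
  unfolding BMO_X_norm_def
proof (rule SUP_least)
  fix Q :: "'a set" assume "Q \<in> {Q. is_cube Q}"
  then have Q: "is_cube Q" by simp
  then obtain a l where l: "l > 0" and Ql: "Q = cube a l" by (rule is_cubeE)
  interpret quasi_banach_function_space Q "X Q" "N Q" using X[OF Q] .
  obtain b where b: "b \<ge> 0" "BMO_norm f = ennreal b" "osc_le b f" using BMO_E[OF f] .
  let ?K = "12 * shift_const TYPE('a) + 3"
  let ?u = "\<lambda>x. f x - average Q f"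
  have K: "?K \<ge> 0" by (simp add: shift_const_def)
  obtain g where g: "osc_le (6 * b) g"
    and dom: "AE x in lebesgue. x \<in> Q \<longrightarrow>
      ennreal \<bar>?u x\<bar> \<le> ennreal ?K * dyadic_maximal Q (\<lambda>x. g x - average Q g) x"
    using oscillation_dominated_by_dyadic_maximal[OF b(3) l, of a] unfolding Ql by blast
  let ?M = "dyadic_maximal Q (\<lambda>x. g x - average Q g)"
  have "extended_qnorm_ennreal Q (X Q) (N Q) ?M \<le> BMO_MX_norm X N g"
    unfolding BMO_MX_norm_def using Q by (intro SUP_upper2[of Q]) simp_all
  also have "\<dots> \<le> ennreal C * BMO_norm g" using osc_le_imp_BMO(1)[OF g] by (rule C)
  also have "\<dots> \<le> ennreal C * ennreal (6 * b)"
    by (intro mult_left_mono osc_le_imp_BMO(2)[OF g]) simp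
  also have "\<dots> = ennreal (C * (6 * b))" using C(2) by (simp only: ennreal_mult')
  finally have "extended_qnorm_ennreal Q (X Q) (N Q) ?M \<le> ennreal (C * (6 * b))" .
  moreover have "0 \<le> C * (6 * b)" using C(2) b(1) by simp
  ultimately have fin: "AE x in lebesgue_on Q. ?M x < \<infinity>" and mem: "(\<lambda>x. enn2real (?M x)) \<in> X Q"
    and N_le: "N Q (\<lambda>x. enn2real (?M x)) \<le> C * (6 * b)"
    by (rule extended_qnorm_ennreal_le)+
  have le: "AE x in lebesgue_on Q. \<bar>?u x\<bar> \<le> ?K * \<bar>enn2real (?M x)\<bar>"
    unfolding AE_lebesgue_on_cube_iff[OF Ql]
    using dom fin[unfolded AE_lebesgue_on_cube_iff[OF Ql]]
  proof eventually_elim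
    case (elim x)
    show ?case
    proof
      assume "x \<in> Q"
      then have "ennreal \<bar>?u x\<bar> \<le> ennreal ?K * ennreal (enn2real (?M x))"
        using elim by simp
      also have "\<dots> = ennreal (?K * enn2real (?M x))" using K by (simp only: ennreal_mult')
      finally show "\<bar>?u x\<bar> \<le> ?K * \<bar>enn2real (?M x)\<bar>"
        using K by (subst (asm) ennreal_le_iff) auto
    qed
  qed
  have "?u \<in> borel_measurable (lebesgue_on Q)"
    using locally_integrable_measurable[OF osc_le_locally_integrable[OF b(3)]]
    by (intro measurable_restrict_space1 borel_measurable_diff) simp_all
  note u = dominated_mem_qnorm_le[OF mem this K le]
  have "N Q ?u \<le> ?K * (C * (6 * b))" using u(2) mult_left_mono[OF N_le K] by (rule order_trans)
  then have "extended_qnorm (X Q) (N Q) ?u \<le> ennreal (?K * (C * (6 * b)))"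
    unfolding extended_qnorm_def if_P[OF u(1)] by (rule ennreal_leI)
  also have "?K * (C * (6 * b)) = (6 * C * ?K) * b" by simp
  also have "ennreal \<dots> = ennreal (6 * C * ?K) * BMO_norm f"
    unfolding b(2) using C(2) K by (intro ennreal_mult') (auto intro!: mult_nonneg_nonneg)
  finally show "extended_qnorm (X Q) (N Q) ?u \<le> ennreal (6 * C * ?K) * BMO_norm f" .
qed

theorem corollary3p5:
  fixes X :: "(real ^ 'n) set \<Rightarrow> ((real ^ 'n) \<Rightarrow> real) set"
    and N :: "(real ^ 'n) set \<Rightarrow> ((real ^ 'n) \<Rightarrow> real) \<Rightarrow> real"
  assumes "normalized_qbfs_family X N"
  shows "(BMO \<subseteq> BMO_X X N \<and>
            (\<exists>C>0. \<forall>f\<in>BMO. BMO_X_norm X N f \<le> ennreal C * BMO_norm f))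
         \<longleftrightarrow>
         (BMO = BMO_MX X N \<and>
            (\<exists>c>0. \<exists>C>0. \<forall>f\<in>BMO.
               ennreal c * BMO_norm f \<le> BMO_MX_norm X N f \<and>
               BMO_MX_norm X N f \<le> ennreal C * BMO_norm f))"
proof -
  have X: "quasi_banach_function_space Q (X Q) (N Q)" if "is_cube Q" for Q
    using assms that by (auto simp: normalized_qbfs_family_def)
  obtain c C0 where c: "c > 0" "C0 > 0"
    and ind: "\<And>Q. is_cube Q \<Longrightarrow> ennreal c \<le> extended_qnorm (X Q) (N Q) (indicator Q)"
      "\<And>Q. is_cube Q \<Longrightarrow> extended_qnorm (X Q) (N Q) (indicator Q) \<le> ennreal C0"
    using assms unfolding normalized_qbfs_family_def by blast
  \<comment> \<open>Stated for all locally integrable \<open>f\<close>, because it also has to show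
    that members of \<open>BMO_MX\<close> have finite \<open>BMO\<close> norm.\<close>
  have lower: "ennreal c * BMO_norm f \<le> BMO_MX_norm X N f" if f: "locally_integrable f" for f
  proof -
    have "ennreal c * ennreal (average Q (\<lambda>x. \<bar>f x - average Q f\<bar>)) \<le> BMO_MX_norm X N f"
      if Q: "is_cube Q" for Q
    proof -
      obtain a l where l: "l > 0" and Ql: "Q = cube a l" using Q by (rule is_cubeE)
      have mem: "indicator Q \<in> X Q" using c(2) by (intro extended_qnorm_leD(1)[OF ind(2)[OF Q]]) simp
      then have "0 \<le> N Q (indicator Q)" using quasi_banach_function_space.nonneg[OF X[OF Q]] by blast
      then have "c \<le> N Q (indicator Q)" using ind(1)[OF Q] mem by (simp add: extended_qnorm_def)
      from average_oscillation_le_BMO_MX_norm[OF X[OF Q] l Ql mem this c(1) f]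
      show ?thesis unfolding BMO_MX_norm_def using Q by (intro SUP_upper2[of Q]) simp_all
    qed
    then show ?thesis
      unfolding BMO_norm_def by (subst SUP_mult_left_ennreal) (auto intro!: SUP_least)
  qed
  have BMO_MX_subset: "BMO_MX X N \<subseteq> BMO"
  proof
    fix f assume "f \<in> BMO_MX X N"
    then have f: "locally_integrable f" "BMO_MX_norm X N f < \<infinity>" by (auto simp: BMO_MX_def)
    then have "ennreal c * BMO_norm f < \<infinity>" using lower[OF f(1)] by (auto intro: le_less_trans)
    then have "BMO_norm f < \<infinity>" using c(1) by (auto simp: ennreal_mult_less_top)
    with f show "f \<in> BMO" by (simp add: BMO_def)
  qed
  have S: "shift_const TYPE(real ^ 'n) > 0" by (simp add: shift_const_def)
  have BMO_loc: "locally_integrable f" "BMO_norm f < \<infinity>" if "f \<in> BMO" for f :: "real ^ 'n \<Rightarrow> real"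
    using that by (auto simp: BMO_def)
  show ?thesis
  proof
    assume "BMO \<subseteq> BMO_X X N \<and> (\<exists>C>0. \<forall>f\<in>BMO. BMO_X_norm X N f \<le> ennreal C * BMO_norm f)"
    then obtain C where C: "C > 0" "\<And>f. f \<in> BMO \<Longrightarrow> BMO_X_norm X N f \<le> ennreal C * BMO_norm f" by blast
    let ?C = "2 * C * (272 * shift_const TYPE(real ^ 'n) + 776)"
    have upper: "BMO_MX_norm X N f \<le> ennreal ?C * BMO_norm f" if "f \<in> BMO" for f
      using BMO_MX_norm_bound[OF X C(2) C(1) that] .
    have "BMO \<subseteq> BMO_MX X N"
    proof
      fix f :: "real ^ 'n \<Rightarrow> real" assume f: "f \<in> BMO"
      have "ennreal ?C * BMO_norm f < \<infinity>" using BMO_loc(2)[OF f] by (simp add: ennreal_mult_less_top)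
      then show "f \<in> BMO_MX X N" using upper[OF f] BMO_loc(1)[OF f] by (auto simp: BMO_MX_def intro: le_less_trans)
    qed
    moreover have "?C > 0" using C(1) S by simp
    ultimately show "BMO = BMO_MX X N \<and> (\<exists>c>0. \<exists>C>0. \<forall>f\<in>BMO.
        ennreal c * BMO_norm f \<le> BMO_MX_norm X N f \<and> BMO_MX_norm X N f \<le> ennreal C * BMO_norm f)"
      using BMO_MX_subset lower[OF BMO_loc(1)] upper c(1) by blast
  next
    assume "BMO = BMO_MX X N \<and> (\<exists>c>0. \<exists>C>0. \<forall>f\<in>BMO.
        ennreal c * BMO_norm f \<le> BMO_MX_norm X N f \<and> BMO_MX_norm X N f \<le> ennreal C * BMO_norm f)"
    then obtain C where C: "C > 0" "\<And>f. f \<in> BMO \<Longrightarrow> BMO_MX_norm X N f \<le> ennreal C * BMO_norm f" by blast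
    let ?C = "6 * C * (12 * shift_const TYPE(real ^ 'n) + 3)"
    have upper: "BMO_X_norm X N f \<le> ennreal ?C * BMO_norm f" if "f \<in> BMO" for f
      using BMO_X_norm_bound[OF X C(2) C(1) that] .
    have "BMO \<subseteq> BMO_X X N"
    proof
      fix f :: "real ^ 'n \<Rightarrow> real" assume f: "f \<in> BMO"
      have "ennreal ?C * BMO_norm f < \<infinity>" using BMO_loc(2)[OF f] by (simp add: ennreal_mult_less_top)
      then show "f \<in> BMO_X X N" using upper[OF f] BMO_loc(1)[OF f] by (auto simp: BMO_X_def intro: le_less_trans)
    qed
    moreover have "?C > 0" using C(1) S by simp
    ultimately show "BMO \<subseteq> BMO_X X N \<and> (\<exists>C>0. \<forall>f\<in>BMO. BMO_X_norm X N f \<le> ennreal C * BMO_norm f)"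
      using upper by blast
  qed
qed

end
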